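(* For every $n\ge 1$, $$\Sigma_n=\sum_{\sigma\in\mathfrak S_n}\mathbf{\Psi}^\sigma \;=\; \sum_{I,J\,\vDash\, n} (-1)^{n-l(I)}\, q^{D(I,J)}\,\Lambda_I^{(J)},$$ where the sum runs over all pairs $(I,J)$ of compositions of $n$ and $l(I)$ is the number of parts of $I$.
   Context: Scalars: $q$ is an indeterminate (scalar parameter). Biwords. For $n\ge 0$, a permutation $\tau\in\mathfrak S_n$ (written as a word) and a word $u=u_1\cdots u_n$ of positive integers (a color word), let $\binom{u}{\tau}$ denote a formal basis element (this is $\mathbf G_{\tau,u}$ in the algebra of colored free quasi-symmetric functions; top row = colors, bottom row = permutation). Product: $\binom{u}{\alpha}\binom{v}{\beta}=\sum_{\gamma\in\alpha*\beta}\binom{uv}{\gamma}$, where, for $\alpha\in\mathfrak S_a$, $\beta\in\mathfrak S_b$, $\alpha*\beta$ is the set (formal sum) of all $\gamma\in\mathfrak S_{a+b}$ which, written $\gamma=xy$ with $|x|=a$, $|y|=b$, satisfy $\mathrm{std}(x)=\alpha$, $\mathrm{std}(y)=\beta$; $\mathrm{std}$ denotes standardization (the permutation with the same relative order of letters). In rows of biwords notation is extended bilinearly. The elements $\Psi^u$. For a color word $u=u_1\cdots u_p$, regard $(u_i,i)$ as biletters, set $B_1=(u_1,1)$ and $B_i=[B_{i-1},(u_i,i)]_q$ for $i\ge2$, where $[x,y]_q=xy-q\,yx$ and products of biletters are concatenation of words in biletters. Interpreting each resulting word in biletters as a biword (colors on top, numbers below), put $\Psi^u:=B_p$. E.g.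 $\Psi^{312}=\binom{312}{123}-q\binom{132}{213}-q\binom{231}{312}+q^2\binom{213}{321}$. A word $u=u_1\cdots u_p$ is initially dominated if $u_1>u_i$ for all $i>1$. Each word has a unique factorization $u=u^{(1)}u^{(2)}\cdots u^{(p)}$ into initially dominated words whose first letters satisfy $u^{(1)}_1\le u^{(2)}_1\le\cdots\le u^{(p)}_1$. For $\sigma\in\mathfrak S_n$ with this factorization, $\mathbf\Psi^\sigma:=\Psi^{u^{(1)}}\Psi^{u^{(2)}}\cdots\Psi^{u^{(p)}}$ (product of biwords above), and the saillance composition of $\sigma$ is $S(\sigma):=(|u^{(1)}|,\dots,|u^{(p)}|)$. Compositions. $I\vDash n$ means $I$ is a composition of $n$. For $I=(i_1,\dots,i_s)\vDash n$, $\mathrm{Des}(I)=\{i_1,i_1+i_2,\dots,i_1+\cdots+i_{s-1}\}\subseteq\{1,\dots,n-1\}$. The descent composition $D(\tau)$ of $\tau\in\mathfrak S_n$ is the composition whose parts are the lengths of the maximal increasing factors of $\tau$. For $I,J\vDash n$ let $R_I^{(J)}:=\sum_{\tau,\sigma\in\mathfrak S_n:\ D(\tau)=I,\ S(\sigma)=J}\binom{\sigma}{\tau}$ and $\Lambda_I^{(J)}:=\sum_{I'}R_{I'}^{(J)}$, the sum being over all compositions $I'$ finer than or equal to the conjugate $\overline I^{\sim}$ of the mirror image $\overline I$ of $I$; equivalently over all $I'\vDash n$ with $\mathrm{Des}(I')\supseteq\{1,\dots,n-1\}\setminus\mathrm{Des}(I)$. E.g. $\Lambda_{32}^{(41)}=R_{1121}^{(41)}+R_{11111}^{(41)}$.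 The statistic $D(I,J)$. For compositions, $(a_1,\dots,a_r)\cdot(b_1,\dots,b_s)=(a_1,\dots,a_r,b_1,\dots,b_s)$ and $(a_1,\dots,a_r)\triangleright(b_1,\dots,b_s)=(a_1,\dots,a_r+b_1,\dots,b_s)$. For $I=(i_1,\dots,i_r)$ and $J$ compositions of $n$, $J\downarrow I=(J^{(1)},\dots,J^{(r)})$ is the unique sequence of compositions with $J^{(k)}\vDash i_k$ and $J=J^{(1)}\circ_1J^{(2)}\circ_2\cdots\circ_{r-1}J^{(r)}$ with each $\circ_i\in\{\cdot,\triangleright\}$. Then $D(I,J):=n-\sum_{k=1}^r(\text{last part of }J^{(k)})$. E.g. for $I=(6,2,2,4,1,4)$, $J=(3,2,4,3,2,5)$: $J\downarrow I=((3,2,1),(2),(1,1),(2,2),(1),(4))$ and $D(I,J)=8$. *)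

theory Defs
  imports
    "HOL-Library.Poly_Mapping"
    "HOL-Combinatorics.Multiset_Permutations"
begin

section \<open>Linear combinations\<close>

text \<open>
  \<open>'a \<Rightarrow>\<^sub>0 'k\<close> is the free \<open>'k\<close>-module on \<open>'a\<close>. An algebra structure on it is given by the product
  of two basis elements, extended bilinearly.
\<close>

definition smult :: "'k::comm_ring_1 \<Rightarrow> ('a \<Rightarrow>\<^sub>0 'k) \<Rightarrow> ('a \<Rightarrow>\<^sub>0 'k)" where
  "smult c F = Poly_Mapping.map ((*) c) F"

definition linear_ext :: "('a \<Rightarrow> ('b \<Rightarrow>\<^sub>0 'k)) \<Rightarrow> ('a \<Rightarrow>\<^sub>0 'k::comm_ring_1) \<Rightarrow> ('b \<Rightarrow>\<^sub>0 'k)" where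
  "linear_ext f F = (\<Sum>x\<in>Poly_Mapping.keys F. smult (Poly_Mapping.lookup F x) (f x))"

definition bilinear_ext ::
  "('a \<Rightarrow> 'b \<Rightarrow> ('c \<Rightarrow>\<^sub>0 'k)) \<Rightarrow> ('a \<Rightarrow>\<^sub>0 'k::comm_ring_1) \<Rightarrow> ('b \<Rightarrow>\<^sub>0 'k) \<Rightarrow> ('c \<Rightarrow>\<^sub>0 'k)" where
  "bilinear_ext f F G = linear_ext (\<lambda>x. linear_ext (\<lambda>y. f x y) G) F"


section \<open>Biwords\<close>

text \<open>
  A biword is a pair \<open>(u, \<tau>)\<close>: \<open>u\<close> is the color word (top row), \<open>\<tau>\<close> a permutation of
  \<open>{1..length u}\<close> written as a word (bottom row). Pairs that are not of this shape are unused
  basis elements of the ambient module.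
\<close>

type_synonym biword = "nat list \<times> nat list"

definition biw :: "nat list \<Rightarrow> nat list \<Rightarrow> (biword \<Rightarrow>\<^sub>0 'k::comm_ring_1)" where
  "biw u \<tau> = Poly_Mapping.single (u, \<tau>) 1"

text \<open>Equal letters are numbered from left to right; below only words without repeated letters occur.\<close>

definition std :: "nat list \<Rightarrow> nat list" where
  "std w = map (\<lambda>i. card {j. j < length w \<and> (w ! j < w ! i \<or> (w ! j = w ! i \<and> j \<le> i))})
             [0..<length w]"

definition convolution :: "nat list \<Rightarrow> nat list \<Rightarrow> nat list set" where
  "convolution \<alpha> \<beta> = {\<gamma> \<in> permutations_of_set {1..length \<alpha> + length \<beta>}.
     std (take (length \<alpha>) \<gamma>) = \<alpha> \<and> std (drop (length \<alpha>) \<gamma>) = \<beta>}"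

definition biw_mult :: "(biword \<Rightarrow>\<^sub>0 'k::comm_ring_1) \<Rightarrow> (biword \<Rightarrow>\<^sub>0 'k) \<Rightarrow> (biword \<Rightarrow>\<^sub>0 'k)" where
  "biw_mult = bilinear_ext (\<lambda>(u, \<alpha>) (v, \<beta>). \<Sum>\<gamma>\<in>convolution \<alpha> \<beta>. biw (u @ v) \<gamma>)"


section \<open>The elements \<open>\<Psi>\<close>\<close>

text \<open>Words in biletters \<open>(color, position)\<close>, multiplied by concatenation.\<close>

type_synonym biletters = "(nat \<times> nat) list"

definition conc_mult ::
  "(biletters \<Rightarrow>\<^sub>0 'k::comm_ring_1) \<Rightarrow> (biletters \<Rightarrow>\<^sub>0 'k) \<Rightarrow> (biletters \<Rightarrow>\<^sub>0 'k)" where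
  "conc_mult = bilinear_ext (\<lambda>v w. Poly_Mapping.single (v @ w) 1)"

definition q_bracket ::
  "'k::comm_ring_1 \<Rightarrow> (biletters \<Rightarrow>\<^sub>0 'k) \<Rightarrow> (biletters \<Rightarrow>\<^sub>0 'k) \<Rightarrow> (biletters \<Rightarrow>\<^sub>0 'k)" where
  "q_bracket q x y = conc_mult x y - smult q (conc_mult y x)"

definition biletter :: "nat \<times> nat \<Rightarrow> (biletters \<Rightarrow>\<^sub>0 'k::comm_ring_1)" where
  "biletter a = Poly_Mapping.single [a] 1"

text \<open>The value at the empty word is a convention that is never used.\<close>

fun iterated_bracket :: "'k::comm_ring_1 \<Rightarrow> biletters \<Rightarrow> (biletters \<Rightarrow>\<^sub>0 'k)" where
  "iterated_bracket q [] = Poly_Mapping.single [] 1"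
| "iterated_bracket q (a # as) = foldl (\<lambda>B b. q_bracket q B (biletter b)) (biletter a) as"

definition Psi :: "'k::comm_ring_1 \<Rightarrow> nat list \<Rightarrow> (biword \<Rightarrow>\<^sub>0 'k)" where
  "Psi q u = linear_ext (\<lambda>w. biw (map fst w) (map snd w))
     (iterated_bracket q (zip u [1..<Suc (length u)]))"

definition initially_dominated :: "nat list \<Rightarrow> bool" where
  "initially_dominated u \<longleftrightarrow> u \<noteq> [] \<and> (\<forall>x\<in>set (tl u). x < hd u)"

definition is_dominated_factorization :: "nat list list \<Rightarrow> nat list \<Rightarrow> bool" where
  "is_dominated_factorization us u \<longleftrightarrow>
     concat us = u \<and> (\<forall>w\<in>set us. initially_dominated w) \<and> sorted (map hd us)"

lemma ex1_dominated_factorization: "\<exists>!us. is_dominated_factorization us u"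
proof (induction u rule: length_induct)
  case (1 u)
  show ?case
  proof (cases u)
    case Nil
    have "is_dominated_factorization us [] \<longleftrightarrow> us = []" for us
      by (cases us) (auto simp: is_dominated_factorization_def initially_dominated_def)
    then show ?thesis using Nil by simp
  next
    case (Cons a u')
    let ?t = "takeWhile (\<lambda>x. x < a) u'" and ?d = "dropWhile (\<lambda>x. x < a) u'"
    have "length ?d < length u"
      using Cons by (simp add: length_dropWhile_le le_imp_less_Suc)
    with 1 have "\<exists>!us. is_dominated_factorization us ?d" by blast
    then obtain vs where vs: "is_dominated_factorization vs ?d"
      and uniq: "\<And>ws. is_dominated_factorization ws ?d \<Longrightarrow> ws = vs" by blast
    show ?thesis
    proof (rule ex1I)
      have "a \<le> hd w" if w: "w \<in> set vs" for w
      proof -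
        obtain v vs' where v: "vs = v # vs'" using w by (cases vs) auto
        with vs have "v \<noteq> []" and d: "?d = v @ concat vs'"
          by (auto simp: is_dominated_factorization_def initially_dominated_def)
        then have "?d \<noteq> []" and "hd ?d = hd v" by auto
        then have "a \<le> hd v" using hd_dropWhile[of "\<lambda>x. x < a" u'] by simp
        also have "hd v \<le> hd w" using w vs v by (auto simp: is_dominated_factorization_def)
        finally show ?thesis .
      qed
      then show "is_dominated_factorization ((a # ?t) # vs) u"
        using vs Cons
        by (auto simp: is_dominated_factorization_def initially_dominated_def
            dest: set_takeWhileD)
    next
      fix us assume us: "is_dominated_factorization us u"
      then obtain w ws where w: "us = w # ws"
        using Cons by (cases us) (auto simp: is_dominated_factorization_def)
      with us Cons have "w \<noteq> []" and "w @ concat ws = a # u'"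
        by (auto simp: is_dominated_factorization_def initially_dominated_def)
      then obtain w' where w': "w = a # w'" and u': "u' = w' @ concat ws"
        by (cases w) auto
      have less: "\<forall>x\<in>set w'. x < a"
        using us w w' by (auto simp: is_dominated_factorization_def initially_dominated_def)
      have ge: "concat ws = [] \<or> \<not> hd (concat ws) < a"
      proof (cases ws)
        case (Cons v vs')
        then have "v \<noteq> []" "a \<le> hd v"
          using us w w' by (auto simp: is_dominated_factorization_def initially_dominated_def)
        then show ?thesis using Cons by simp
      qed simp
      have "takeWhile (\<lambda>x. x < a) ys = [] \<and> dropWhile (\<lambda>x. x < a) ys = ys"
        if "ys = [] \<or> \<not> hd ys < a" for ys
        using that by (cases ys) auto
      from this[OF ge] have t: "?t = w'" and d: "?d = concat ws"
        using less u' by auto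
      have "is_dominated_factorization ws ?d"
        using us w d by (auto simp: is_dominated_factorization_def)
      then have "ws = vs" by (rule uniq)
      then show "us = (a # ?t) # vs" using w w' t by simp
    qed
  qed
qed

definition dominated_factorization :: "nat list \<Rightarrow> nat list list" where
  "dominated_factorization u = (THE us. is_dominated_factorization us u)"

definition Psi_perm :: "'k::comm_ring_1 \<Rightarrow> nat list \<Rightarrow> (biword \<Rightarrow>\<^sub>0 'k)" where
  "Psi_perm q \<sigma> = foldr biw_mult (map (Psi q) (dominated_factorization \<sigma>)) (biw [] [])"

definition saillance_comp :: "nat list \<Rightarrow> nat list" where
  "saillance_comp \<sigma> = map length (dominated_factorization \<sigma>)"


section \<open>Compositions\<close>

definition compositions :: "nat \<Rightarrow> nat list set" where
  "compositions n = {I. 0 \<notin> set I \<and> sum_list I = n}"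

lemma finite_compositions: "finite (compositions n)"
proof (rule finite_subset)
  have "length I \<le> sum_list I" if "0 \<notin> set I" for I :: "nat list"
    using that by (induction I) auto
  then show "compositions n \<subseteq> {I. set I \<subseteq> {..n} \<and> length I \<le> n}"
    by (auto simp: compositions_def dest: member_le_sum_list)
  show "finite {I. set I \<subseteq> {..n} \<and> length I \<le> n}"
    by (rule finite_lists_length_le) simp
qed

definition Des :: "nat list \<Rightarrow> nat set" where
  "Des I = {sum_list (take k I) | k. 1 \<le> k \<and> k < length I}"

fun increasing_runs :: "nat list \<Rightarrow> nat list list" where
  "increasing_runs [] = []"
| "increasing_runs (x # xs) =
     (case increasing_runs xs of
        [] \<Rightarrow> [[x]]
      | r # rs \<Rightarrow> if x < hd r then (x # r) # rs else [x] # r # rs)"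

definition descent_comp :: "nat list \<Rightarrow> nat list" where
  "descent_comp \<tau> = map length (increasing_runs \<tau>)"

text \<open>In the next two definitions both compositions are compositions of \<open>n = sum_list I\<close>.\<close>

definition ribbon :: "nat list \<Rightarrow> nat list \<Rightarrow> (biword \<Rightarrow>\<^sub>0 'k::comm_ring_1)" where
  "ribbon I J =
     (\<Sum>\<tau>\<in>{\<tau> \<in> permutations_of_set {1..sum_list I}. descent_comp \<tau> = I}.
      \<Sum>\<sigma>\<in>{\<sigma> \<in> permutations_of_set {1..sum_list I}. saillance_comp \<sigma> = J}. biw \<sigma> \<tau>)"

text \<open>
  The descent set of the conjugate of the mirror image of \<open>I\<close> is the complement of \<open>Des I\<close> in
  \<open>{1..n-1}\<close>, and \<open>I'\<close> is finer than or equal to it iff \<open>Des I'\<close> contains that complement.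
\<close>

definition Lam :: "nat list \<Rightarrow> nat list \<Rightarrow> (biword \<Rightarrow>\<^sub>0 'k::comm_ring_1)" where
  "Lam I J = (\<Sum>I'\<in>{I' \<in> compositions (sum_list I). {1..<sum_list I} - Des I \<subseteq> Des I'}. ribbon I' J)"


section \<open>The statistic \<open>D(I, J)\<close>\<close>

text \<open>The operation written as a triangle; it is only applied to nonempty compositions.\<close>

definition near_concat :: "nat list \<Rightarrow> nat list \<Rightarrow> nat list" where
  "near_concat A B = butlast A @ [last A + hd B] @ tl B"

text \<open>
  \<open>glued Js J\<close>: \<open>J\<close> is obtained from the members of \<open>Js\<close> by joining consecutive ones by either of
  the two operations. Bracketing to the right is no restriction, as the two operations associate
  with each other on nonempty lists.
\<close>

inductive glued :: "nat list list \<Rightarrow> nat list \<Rightarrow> bool" where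
  "glued [A] A"
| "glued As B \<Longrightarrow> glued (A # As) (A @ B)"
| "glued As B \<Longrightarrow> glued (A # As) (near_concat A B)"

definition is_restriction :: "nat list \<Rightarrow> nat list \<Rightarrow> nat list list \<Rightarrow> bool" where
  "is_restriction J I Js \<longleftrightarrow> list_all2 (\<lambda>A i. A \<in> compositions i) Js I \<and> glued Js J"

lemma joining_exists:
  assumes "0 \<notin> set J" and "sum_list J = i + m" and "0 < i" and "0 < m"
  shows "\<exists>A\<in>compositions i. \<exists>B\<in>compositions m. J = A @ B \<or> J = near_concat A B"
  using assms
proof (induction J arbitrary: i)
  case (Cons j J)
  consider "j < i" | "j = i" | "i < j" by linarith
  then show ?case
  proof cases
    case 1
    then have "sum_list J = (i - j) + m" "0 < i - j" using Cons.prems by auto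
    with Cons.IH[of "i - j"] Cons.prems obtain A B
      where "A \<in> compositions (i - j)" "B \<in> compositions m" "J = A @ B \<or> J = near_concat A B"
      by auto
    with 1 Cons.prems show ?thesis
      by (intro bexI[of _ "j # A"] bexI[of _ B]) (auto simp: compositions_def near_concat_def)
  next
    case 2
    with Cons.prems show ?thesis
      by (intro bexI[of _ "[j]"] bexI[of _ J]) (auto simp: compositions_def)
  next
    case 3
    with Cons.prems show ?thesis
      by (intro bexI[of _ "[i]"] bexI[of _ "(j - i) # J"])
        (auto simp: compositions_def near_concat_def)
  qed
qed simp

lemma joining_unique:
  assumes "0 \<notin> set A" "0 \<notin> set A'" "0 \<notin> set B" "0 \<notin> set B'" "A \<noteq> []" "A' \<noteq> []" "B \<noteq> []" "B' \<noteq> []"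
    and "sum_list A = sum_list A'"
    and "J = A @ B \<or> J = near_concat A B" "J = A' @ B' \<or> J = near_concat A' B'"
  shows "A = A' \<and> B = B'"
  using assms
proof (induction A arbitrary: A' J)
  case (Cons a A)
  obtain a' A'' where A': "A' = a' # A''" using Cons.prems by (cases A') auto
  obtain b C where B: "B = b # C" using Cons.prems by (cases B) auto
  obtain b' C' where B': "B' = b' # C'" using Cons.prems by (cases B') auto
  show ?case
  proof (cases "A = [] \<or> A'' = []")
    case True
    then show ?thesis
      using Cons.prems A' B B' by (cases A; cases A'') (auto simp: near_concat_def)
  next
    case False
    then have "hd J = a" "hd J = a'"
      using Cons.prems A' by (auto simp: near_concat_def)
    moreover have "tl J = A @ B \<or> tl J = near_concat A B"
      "tl J = A'' @ B' \<or> tl J = near_concat A'' B'"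
      using Cons.prems(10,11) A' False by (auto simp: near_concat_def)
    ultimately show ?thesis
      using Cons.IH[of A'' "tl J"] Cons.prems False A' by auto
  qed
qed simp

lemma glued_Cons_iff:
  "glued (A # As) J \<longleftrightarrow>
     (if As = [] then J = A else \<exists>B. glued As B \<and> (J = A @ B \<or> J = near_concat A B))"
proof -
  have "\<not> glued [] B" for B by (auto elim: glued.cases)
  then show ?thesis
    by (subst glued.simps) auto
qed

lemma glued_composition:
  assumes "list_all2 (\<lambda>A i. A \<in> compositions i) Js I" "glued Js J" "0 \<notin> set I"
  shows "J \<in> compositions (sum_list I)"
  using assms
proof (induction Js I arbitrary: J rule: list_all2_induct)
  case Nil
  then show ?case by (auto elim: glued.cases)
next
  case (Cons A As i I)
  show ?case
  proof (cases "As = []")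
    case True
    then show ?thesis using Cons by (auto simp: glued_Cons_iff)
  next
    case False
    then obtain B where B: "glued As B" "J = A @ B \<or> J = near_concat A B"
      using Cons.prems by (auto simp: glued_Cons_iff)
    then have B': "B \<in> compositions (sum_list I)" using Cons by auto
    have "I \<noteq> []" using Cons.hyps False by auto
    then have "0 < sum_list I" using Cons.prems by (cases I) auto
    moreover have "sum_list B = sum_list I" using B' by (simp add: compositions_def)
    ultimately have "B \<noteq> []" by (metis less_irrefl sum_list.Nil)
    then obtain b C where C: "B = b # C" by (cases B) auto
    have "A \<noteq> []" using Cons by (auto simp: compositions_def)
    then obtain A' a where "A = A' @ [a]" by (cases A rule: rev_cases) auto
    then show ?thesis
      using B B' C Cons.hyps by (auto simp: compositions_def near_concat_def)
  qed
qed

lemma ex1_restriction: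
  assumes "I \<in> compositions n" and "J \<in> compositions n" and "n \<ge> 1"
  shows "\<exists>!Js. is_restriction J I Js"
  using assms
proof (induction I arbitrary: J n)
  case Nil
  then show ?case by (simp add: compositions_def)
next
  case (Cons i I)
  show ?case
  proof (cases "I = []")
    case True
    then show ?thesis
      using Cons.prems
      by (intro ex1I[of _ "[J]"])
        (auto simp: is_restriction_def list_all2_Cons2 glued_Cons_iff compositions_def)
  next
    case False
    define m where "m = sum_list I"
    have I: "I \<in> compositions m" "0 < i" "n = i + m" "0 \<notin> set I"
      using Cons.prems by (auto simp: m_def compositions_def)
    then have m: "0 < m" using False by (cases I) (auto simp: m_def)
    obtain A B where AB: "A \<in> compositions i" "B \<in> compositions m" "J = A @ B \<or> J = near_concat A B"
      using joining_exists[of J i m] Cons.prems I m by (auto simp: compositions_def)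
    obtain Bs where Bs: "is_restriction B I Bs"
      and uniq: "\<And>Cs. is_restriction B I Cs \<Longrightarrow> Cs = Bs"
      using Cons.IH[OF I(1) AB(2)] m by auto
    show ?thesis
    proof (rule ex1I)
      have "Bs \<noteq> []" using Bs False by (auto simp: is_restriction_def)
      then show "is_restriction J (i # I) (A # Bs)"
        using AB Bs by (auto simp: is_restriction_def glued_Cons_iff)
    next
      fix Js assume Js: "is_restriction J (i # I) Js"
      then obtain A' As where A': "Js = A' # As" "A' \<in> compositions i"
        "list_all2 (\<lambda>A i. A \<in> compositions i) As I"
        by (auto simp: is_restriction_def list_all2_Cons2)
      then have "As \<noteq> []" using False by auto
      then obtain B' where B': "glued As B'" "J = A' @ B' \<or> J = near_concat A' B'"
        using Js A'(1) by (auto simp: is_restriction_def glued_Cons_iff)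
      have B'm: "B' \<in> compositions m"
        using glued_composition[OF A'(3) B'(1) I(4)] by (simp add: m_def)
      have ne: "C \<noteq> []" if "C \<in> compositions k" "0 < k" for C k
        using that by (auto simp: compositions_def)
      have pos: "0 \<notin> set C" if "C \<in> compositions k" for C k
        using that by (simp add: compositions_def)
      have "sum_list A = sum_list A'"
        using AB(1) A'(2) by (simp add: compositions_def)
      then have "A = A' \<and> B = B'"
        using joining_unique[OF pos[OF AB(1)] pos[OF A'(2)] pos[OF AB(2)] pos[OF B'm]
            ne[OF AB(1) I(2)] ne[OF A'(2) I(2)] ne[OF AB(2) m] ne[OF B'm m] _ AB(3) B'(2)]
        by blast
      then show "Js = A # Bs"
        using uniq[of As] A' B' by (auto simp: is_restriction_def)
    qed
  qed
qed

definition comp_restrict :: "nat list \<Rightarrow> nat list \<Rightarrow> nat list list" where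
  "comp_restrict J I = (THE Js. is_restriction J I Js)"

definition D_stat :: "nat list \<Rightarrow> nat list \<Rightarrow> nat" where
  "D_stat I J = sum_list I - (\<Sum>A\<leftarrow>comp_restrict J I. last A)"

end

theory Submission
  imports Defs
begin

text \<open>
  Compare the coefficients of a biword \<open>(c, \<tau>)\<close>. Expanding the iterated brackets, a term on the left
  is a factorization of the biword into blocks such that \<open>\<tau>\<close> first decreases and then increases on
  each block, the valley sits below the maximum of the colors of the block, and this maximum is a
  left-to-right maximum (record) of \<open>c\<close>; the weight is \<open>(-q)\<close> to the number of letters left of the
  valley. On the right, the terms are the factorizations into blocks on which \<open>\<tau>\<close> decreases; a block
  of length \<open>l\<close> has weight \<open>(-1) ^ (l - 1) q ^ p\<close>, where \<open>p\<close> is the offset of its last record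
  (\<open>0\<close> if it has none). Group the latter blocks by merging a block with a record and the blocks
  without record that follow it: by inclusion-exclusion over the descents after the last record,
  the signed sum forces \<open>\<tau>\<close> to increase there, which gives the left-hand side.
\<close>

section \<open>Factorizations into blocks\<close>

text \<open>Both coefficients of \<open>(c, \<tau>)\<close> depend only on the records of
  \<open>c\<close> and the descents of \<open>\<tau>\<close>, so the theorem becomes an identity
  between two sums over compositions of products of block weights, for arbitrary predicates in place
  of records and descents. On the right the sum over \<open>J\<close> collapses, as \<open>J\<close>
  has to be the saillance composition of \<open>c\<close>; it encodes where the records are, and
  this turns \<open>D(I, J)\<close> into a sum of offsets, one per block. On the left
  \<open>\<sigma>\<close> is usually not \<open>c\<close>: the factors permute the colors inside a
  block, so the word of a block has to be recovered from both rows, and the condition on first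
  letters becomes one on block maxima. The obstacle is that the regrouping fails at a start that is
  no record: a decreasing block may end just before such a position, and no left-hand block fits
  there. The induction therefore runs over all starts and keeps track of an increasing prefix
  without records. At the start of \<open>c\<close> this prefix is empty, because the first letter
  is always a record.\<close>

lemma length_le_composition: "I \<in> compositions n \<Longrightarrow> length I \<le> n"
proof -
  have "length I \<le> sum_list I" if "0 \<notin> set I" for I :: "nat list"
    using that by (induction I) auto
  then show "I \<in> compositions n \<Longrightarrow> length I \<le> n" by (auto simp: compositions_def)
qed

lemma compositions_0 [simp]: "compositions 0 = {[]}"
proof -
  have "I = []" if "0 \<notin> set I" "sum_list I = 0" for I :: "nat list"
    using that by (cases I) auto
  then show ?thesis by (auto simp: compositions_def)
qed

lemma Cons_in_compositions_iff:
  "i # I \<in> compositions n \<longleftrightarrow> 0 < i \<and> i \<le> n \<and> I \<in> compositions (n - i)"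
  by (auto simp: compositions_def)

section \<open>Sums over all ways to cut an interval into blocks\<close>

lemma sum_compositions:
  assumes "s < n"
  shows "(\<Sum>I\<in>compositions (n - s). h I) =
    (\<Sum>e\<in>{s<..n}. \<Sum>I\<in>compositions (n - e). h ((e - s) # I))"
proof -
  have "(\<Sum>e\<in>{s<..n}. \<Sum>I\<in>compositions (n - e). h ((e - s) # I)) =
      (\<Sum>(e, I)\<in>(SIGMA e:{s<..n}. compositions (n - e)). h ((e - s) # I))"
    by (rule sum.Sigma) (auto simp: finite_compositions)
  also have "\<dots> = (\<Sum>I\<in>compositions (n - s). h I)"
  proof (rule sum.reindex_bij_witness[where i = "\<lambda>I. (s + hd I, tl I)" and j = "\<lambda>(e, I). (e - s) # I"])
    fix I assume I: "I \<in> compositions (n - s)"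
    with assms have "I \<noteq> []" by (auto simp: compositions_def)
    then obtain i I' where [simp]: "I = i # I'" by (cases I) auto
    show "(s + hd I, tl I) \<in> (SIGMA e:{s<..n}. compositions (n - e))"
      "(case (s + hd I, tl I) of (e, I) \<Rightarrow> (e - s) # I) = I"
      using I assms by (auto simp: Cons_in_compositions_iff)
  qed (auto simp: Cons_in_compositions_iff)
  finally show ?thesis by simp
qed

text \<open>\<open>f s e\<close> is the weight of the block \<open>[s, e)\<close>. Endpoints are
  absolute positions, since a weight depends on which letters the block covers and not just on its
  length.\<close>

fun path_prod :: "(nat \<Rightarrow> nat \<Rightarrow> 'a::comm_ring_1) \<Rightarrow> nat \<Rightarrow> nat list \<Rightarrow> 'a" where
  "path_prod f s [] = 1"
| "path_prod f s (i # I) = f s (s + i) * path_prod f (s + i) I"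

definition path_sum :: "(nat \<Rightarrow> nat \<Rightarrow> 'a::comm_ring_1) \<Rightarrow> nat \<Rightarrow> nat \<Rightarrow> 'a" where
  "path_sum f n s = (\<Sum>I\<in>compositions (n - s). path_prod f s I)"

lemma path_sum_self [simp]: "path_sum f n n = 1"
  by (simp add: path_sum_def)

lemma path_sum_step:
  "s < n \<Longrightarrow> path_sum f n s = (\<Sum>e\<in>{s<..n}. f s e * path_sum f n e)"
  by (simp add: path_sum_def sum_compositions sum_distrib_left)

section \<open>Monotone blocks and their alternating sum\<close>

definition decr :: "(nat \<Rightarrow> bool) \<Rightarrow> nat \<Rightarrow> nat \<Rightarrow> bool" where
  "decr d s e \<longleftrightarrow> (\<forall>i. s \<le> i \<and> Suc i < e \<longrightarrow> d i)"

definition incr :: "(nat \<Rightarrow> bool) \<Rightarrow> nat \<Rightarrow> nat \<Rightarrow> bool" where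
  "incr d s e \<longleftrightarrow> (\<forall>i. s \<le> i \<and> Suc i < e \<longrightarrow> \<not> d i)"

text \<open>\<open>d i\<close> concerns the pair \<open>(i, i + 1)\<close>, so a block constrains
  only the pairs inside it. The two pieces overlap in the position \<open>p\<close>; otherwise the
  pair that ends at \<open>p\<close> would be lost.\<close>

lemma decr_split: "s \<le> p \<Longrightarrow> p < e \<Longrightarrow> decr d s e \<longleftrightarrow> decr d s (Suc p) \<and> decr d p e"
proof
  assume *: "decr d s (Suc p) \<and> decr d p e"
  show "decr d s e"
    unfolding decr_def
  proof (intro allI impI)
    fix i assume "s \<le> i \<and> Suc i < e"
    with * show "d i" by (cases "i < p") (auto simp: decr_def)
  qed
qed (auto simp: decr_def)

lemma incr_split: "s \<le> p \<Longrightarrow> p < e \<Longrightarrow> incr d s e \<longleftrightarrow> incr d s (Suc p) \<and> incr d p e"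
  using decr_split[of s p e "\<lambda>i. \<not> d i"] by (simp add: incr_def decr_def)

lemma decr_two [simp]: "decr d s (Suc (Suc s)) \<longleftrightarrow> d s"
  by (auto simp: decr_def less_Suc_eq_le)

lemma incr_two [simp]: "incr d s (Suc (Suc s)) \<longleftrightarrow> \<not> d s"
  by (auto simp: incr_def less_Suc_eq_le)

lemma incr_self [simp]: "incr d s s"
  by (auto simp: incr_def)

text \<open>Coefficient form of the relation \<open>sum_k (-1)^k Lambda_k S_(m-k) = 0\<close>
  between elementary and complete noncommutative symmetric functions, solved for the term
  \<open>k = 0\<close>. The induction removes the first position: all terms except the one with
  \<open>e = Suc p\<close> need \<open>d p\<close> and change sign.\<close>

lemma alternating_decr_incr_sum:
  assumes "p < j"
  shows "(\<Sum>e\<in>{p<..j}. (if decr d p e \<and> incr d e j then (-1) ^ (e - Suc p) else 0)) =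
    (if incr d p j then 1 else (0::'a::comm_ring_1))"
  using assms
proof (induction "j - p" arbitrary: p)
  case (Suc m)
  show ?case
  proof (cases "j = Suc p")
    case True
    have "{p<..j} = {j}" using True by auto
    moreover have "decr d p j" "incr d p j" using True by (auto simp: decr_def incr_def)
    ultimately show ?thesis using True by simp
  next
    case False
    with Suc.prems have j: "Suc p < j" by simp
    have IH: "(\<Sum>e\<in>{Suc p<..j}. (if decr d (Suc p) e \<and> incr d e j then (-1) ^ (e - Suc (Suc p)) else 0)) =
      (if incr d (Suc p) j then 1 else (0::'a))"
      using Suc.hyps(2) j by (intro Suc.hyps(1)) linarith+
    have split: "{p<..j} = insert (Suc p) {Suc p<..j}" using j by auto
    have decr: "decr d p e \<longleftrightarrow> d p \<and> decr d (Suc p) e" if "e \<in> {Suc p<..j}" for e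
      using that decr_split[of p "Suc p" e d] by simp
    have incr: "incr d p j \<longleftrightarrow> \<not> d p \<and> incr d (Suc p) j"
      using j incr_split[of p "Suc p" j d] by simp
    have "(\<Sum>e\<in>{Suc p<..j}. (if decr d p e \<and> incr d e j then (-1) ^ (e - Suc p) else 0)) =
        (\<Sum>e\<in>{Suc p<..j}. (if d p then - 1 else 0) *
          (if decr d (Suc p) e \<and> incr d e j then (-1) ^ (e - Suc (Suc p)) else (0::'a)))"
    proof (rule sum.cong[OF refl])
      fix e assume e: "e \<in> {Suc p<..j}"
      then have eq: "e - Suc p = Suc (e - Suc (Suc p))" by auto
      have pw: "(-1) ^ (e - Suc p) = - ((-1) ^ (e - Suc (Suc p)) :: 'a)"
        unfolding eq by simp
      show "(if decr d p e \<and> incr d e j then (-1) ^ (e - Suc p) else 0) =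
        (if d p then - 1 else 0) *
          (if decr d (Suc p) e \<and> incr d e j then (-1) ^ (e - Suc (Suc p)) else (0::'a))"
        using decr[OF e] pw by auto
    qed
    also have "\<dots> = (if d p then - 1 else 0) * (if incr d (Suc p) j then 1 else (0::'a))"
      by (simp only: sum_distrib_left[symmetric] IH)
    finally show ?thesis
      unfolding split using j incr by (subst sum.insert) (auto simp: decr_def)
  qed
qed simp

text \<open>Positions in \<open>[s, s + k)\<close> are given relative to \<open>s\<close>; the value is also \<open>0\<close> if none satisfies \<open>r\<close>.\<close>

fun last_true :: "(nat \<Rightarrow> bool) \<Rightarrow> nat \<Rightarrow> nat \<Rightarrow> nat" where
  "last_true r s 0 = 0"
| "last_true r s (Suc k) = (if r (s + k) then k else last_true r s k)"

lemma last_true_less: "0 < k \<Longrightarrow> last_true r s k < k"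
  by (induction k) (auto simp: less_Suc_eq)

lemma last_true_none: "(\<And>i. s \<le> i \<Longrightarrow> i < s + k \<Longrightarrow> \<not> r i) \<Longrightarrow> last_true r s k = 0"
  by (induction k) auto

lemma last_true_eqI:
  assumes "r (s + p)" "p < k" "\<And>i. s + p < i \<Longrightarrow> i < s + k \<Longrightarrow> \<not> r i"
  shows "last_true r s k = p"
  using assms by (induction k) (auto simp: less_Suc_eq)

lemma ex_last_true:
  assumes "\<exists>i\<in>{s..<s + k}. r i"
  shows "r (s + last_true r s k) \<and> (\<forall>i. s + last_true r s k < i \<and> i < s + k \<longrightarrow> \<not> r i)"
  using assms
proof (induction k)
  case (Suc k)
  show ?case
  proof (cases "r (s + k)")
    case False
    then have "\<exists>i\<in>{s..<s + k}. r i"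
      using Suc.prems by (auto simp: less_Suc_eq)
    with Suc.IH False show ?thesis by (auto simp: less_Suc_eq)
  qed auto
qed simp

section \<open>Block weights of the two sides and their comparison\<close>

definition dec_weight :: "'a::comm_ring_1 \<Rightarrow> (nat \<Rightarrow> bool) \<Rightarrow> (nat \<Rightarrow> bool) \<Rightarrow> nat \<Rightarrow> nat \<Rightarrow> 'a" where
  "dec_weight q r d s e =
     (if decr d s e then (-1) ^ (e - Suc s) * q ^ last_true r s (e - s) else 0)"

text \<open>\<open>last_true\<close> returns \<open>0\<close> also when there is no record. This
  default is right in \<open>dec_weight\<close>, where the exponent should then vanish; here a block
  without record must have weight \<open>0\<close>, hence the explicit existence. The two monotone
  parts share the valley \<open>s + p\<close>.\<close>

definition valley_weight :: "'a::comm_ring_1 \<Rightarrow> (nat \<Rightarrow> bool) \<Rightarrow> (nat \<Rightarrow> bool) \<Rightarrow> nat \<Rightarrow> nat \<Rightarrow> 'a" where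
  "valley_weight q r d s e = (let p = last_true r s (e - s) in
     if (\<exists>i\<in>{s..<e}. r i) \<and> decr d s (Suc (s + p)) \<and> incr d (s + p) e then (- q) ^ p else 0)"

text \<open>\<open>e\<close> ends a decreasing block, and \<open>[e, j)\<close> is an increasing
  rest without records. If \<open>[s, j)\<close> contains a record, the last one lies in
  \<open>[s, e)\<close>; everything left of it is common to all terms, and what remains is the
  alternating sum that starts there. Without a record the exponent is \<open>0\<close> and the
  alternating sum starts at \<open>s\<close>, which gives the second summand.\<close>

lemma dec_weight_valley_weight:
  assumes "s < j"
  shows "(\<Sum>e\<in>{s<..j}. if (\<forall>i\<in>{e..<j}. \<not> r i) \<and> incr d e j then dec_weight q r d s e else 0) =
    valley_weight q r d s j + (if (\<forall>i\<in>{s..<j}. \<not> r i) \<and> incr d s j then 1 else 0)"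
proof (cases "\<exists>i\<in>{s..<j}. r i")
  case False
  then have [simp]: "\<not> r i" if "s \<le> i" "i < j" for i using that by auto
  have "last_true r s (e - s) = 0" if "e \<in> {s<..j}" for e
    using that by (intro last_true_none) auto
  then have "(\<Sum>e\<in>{s<..j}. if (\<forall>i\<in>{e..<j}. \<not> r i) \<and> incr d e j then dec_weight q r d s e else 0) =
    (\<Sum>e\<in>{s<..j}. if decr d s e \<and> incr d e j then (-1) ^ (e - Suc s) else 0)"
    by (intro sum.cong) (auto simp: dec_weight_def)
  also have "\<dots> = (if incr d s j then 1 else 0)"
    by (rule alternating_decr_incr_sum) fact
  finally show ?thesis using False by (auto simp: valley_weight_def)
next
  case True
  define p where "p = last_true r s (j - s)"
  have p: "r (s + p)" "\<And>i. s + p < i \<Longrightarrow> i < j \<Longrightarrow> \<not> r i" "s + p < j"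
    using ex_last_true[of s "j - s" r] True assms last_true_less[of "j - s" r s]
    by (auto simp: p_def)
  have dd: "decr d s e \<longleftrightarrow> decr d s (Suc (s + p)) \<and> decr d (s + p) e" if "s + p < e" for e
    using that by (intro decr_split) auto
  have lt: "last_true r s (e - s) = p" if "e \<in> {s + p<..j}" for e
    using that by (intro last_true_eqI) (auto simp: p)
  have "(\<Sum>e\<in>{s<..j}. if (\<forall>i\<in>{e..<j}. \<not> r i) \<and> incr d e j then dec_weight q r d s e else 0) =
    (\<Sum>e\<in>{s + p<..j}. if incr d e j then dec_weight q r d s e else 0)"
  proof (rule sum.mono_neutral_cong_right)
    \<comment> \<open>For \<open>e \<le> s + p\<close> the record at \<open>s + p\<close> lies in
      \<open>[e, j)\<close>.\<close>
    show "\<forall>e\<in>{s<..j} - {s + p<..j}.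
      (if (\<forall>i\<in>{e..<j}. \<not> r i) \<and> incr d e j then dec_weight q r d s e else 0) = 0"
      using p(1,3) by (auto dest: bspec[of _ _ "s + p"])
    show "\<And>e. e \<in> {s + p<..j} \<Longrightarrow>
      (if (\<forall>i\<in>{e..<j}. \<not> r i) \<and> incr d e j then dec_weight q r d s e else 0) =
      (if incr d e j then dec_weight q r d s e else 0)"
      using p(2) by auto
  qed auto
  also have "\<dots> = (\<Sum>e\<in>{s + p<..j}. (if decr d s (Suc (s + p)) then (- q) ^ p else 0) *
      (if decr d (s + p) e \<and> incr d e j then (-1) ^ (e - Suc (s + p)) else 0))"
  proof (rule sum.cong[OF refl])
    fix e assume e: "e \<in> {s + p<..j}"
    then have eq: "e - Suc s = p + (e - Suc (s + p))" by auto
    \<comment> \<open>The signs of the \<open>p\<close> letters left of the last record join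
      \<open>q ^ p\<close>; the other signs run the alternating sum from
      \<open>s + p\<close>.\<close>
    have "(-1) ^ (e - Suc s) * q ^ p = (- q) ^ p * (-1) ^ (e - Suc (s + p))"
      unfolding eq power_minus[of q p] by (simp add: power_add ac_simps)
    then show "(if incr d e j then dec_weight q r d s e else 0) =
      (if decr d s (Suc (s + p)) then (- q) ^ p else 0) *
      (if decr d (s + p) e \<and> incr d e j then (-1) ^ (e - Suc (s + p)) else 0)"
      using dd[of e] lt[OF e] e by (auto simp: dec_weight_def)
  qed
  also have "\<dots> = (if decr d s (Suc (s + p)) then (- q) ^ p else 0) * (if incr d (s + p) j then 1 else 0)"
    by (simp only: sum_distrib_left[symmetric] alternating_decr_incr_sum[OF p(3)])
  finally show ?thesis using True by (auto simp: valley_weight_def Let_def p_def[symmetric])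
qed

text \<open>The interval \<open>[s, j)\<close> is what lies in front of the first valley block; no
  valley block can cover it for lack of a record. Splitting off a decreasing block leads to starts
  that need not be records, so the statement for all \<open>s\<close> is the one that induction can
  carry.\<close>

lemma path_sum_dec_weight:
  assumes "s \<le> n"
  shows "path_sum (dec_weight q r d) n s =
    (\<Sum>j\<in>{s..n}. if (\<forall>i\<in>{s..<j}. \<not> r i) \<and> incr d s j then path_sum (valley_weight q r d) n j else 0)"
  using assms
proof (induction "n - s" arbitrary: s rule: less_induct)
  case less
  let ?f = "dec_weight q r d" and ?g = "valley_weight q r d"
  let ?n = "\<lambda>s j. (\<forall>i\<in>{s..<j}. \<not> r i) \<and> incr d s j"
  show ?case
  proof (cases "s = n")
    case True
    then show ?thesis by simp
  next
    case False
    with less.prems have s: "s < n" by simp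
    have "path_sum ?f n s = (\<Sum>e\<in>{s<..n}. ?f s e * path_sum ?f n e)"
      using s by (rule path_sum_step)
    also have "\<dots> = (\<Sum>e\<in>{s<..n}. \<Sum>j\<in>{e..n}. (if ?n e j then ?f s e else 0) * path_sum ?g n j)"
      using less.hyps s by (intro sum.cong) (auto simp: sum_distrib_left intro!: sum.cong)
    \<comment> \<open>For fixed \<open>j\<close> the inner sum now runs over the splittings of
      \<open>[s, j)\<close> into a decreasing block and an increasing rest without records, as in
      \<open>dec_weight_valley_weight\<close>.\<close>
    also have "\<dots> = (\<Sum>j\<in>{s<..n}. \<Sum>e\<in>{s<..j}. (if ?n e j then ?f s e else 0) * path_sum ?g n j)"
      by (subst (1 2) sum.Sigma; (simp; fail)?)
        (rule sum.reindex_bij_witness[where i = prod.swap and j = prod.swap]; auto)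
    also have "\<dots> = (\<Sum>j\<in>{s<..n}. (?g s j + (if ?n s j then 1 else 0)) * path_sum ?g n j)"
      by (intro sum.cong refl) (simp add: sum_distrib_right[symmetric] dec_weight_valley_weight)
    also have "\<dots> = path_sum ?g n s + (\<Sum>j\<in>{s<..n}. if ?n s j then path_sum ?g n j else 0)"
      unfolding path_sum_step[OF s, of ?g] sum.distrib[symmetric]
      by (intro sum.cong) (auto simp: algebra_simps)
    \<comment> \<open>\<open>path_sum ?g n s\<close> is the missing term \<open>j = s\<close>, whose
      conditions hold for the empty interval.\<close>
    also have "{s..n} = insert s {s<..n}" using s by auto
    then have "path_sum ?g n s + (\<Sum>j\<in>{s<..n}. if ?n s j then path_sum ?g n j else 0) =
      (\<Sum>j\<in>{s..n}. if ?n s j then path_sum ?g n j else 0)"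
      by simp
    finally show ?thesis .
  qed
qed

text \<open>A record at \<open>s\<close> rules out every prefix \<open>[s, j)\<close> with
  \<open>j > s\<close>.\<close>

lemma path_sum_dec_eq_valley:
  assumes "r s" "s \<le> n"
  shows "path_sum (dec_weight q r d) n s = path_sum (valley_weight q r d) n s"
proof -
  have "path_sum (dec_weight q r d) n s =
    (\<Sum>j\<in>{s}. if (\<forall>i\<in>{s..<j}. \<not> r i) \<and> incr d s j then path_sum (valley_weight q r d) n j else 0)"
    unfolding path_sum_dec_weight[OF assms(2)]
    by (rule sum.mono_neutral_right) (use assms in auto)
  then show ?thesis by simp
qed

section \<open>Descents, records and the statistic \<open>D(I, J)\<close>\<close>

text \<open>The interval \<open>[s, s + k)\<close> is cut before each of its positions that satisfies \<open>r\<close>, whether or not \<open>r s\<close> holds.\<close>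

fun run_lengths :: "(nat \<Rightarrow> bool) \<Rightarrow> nat \<Rightarrow> nat \<Rightarrow> nat list" where
  "run_lengths r s 0 = []"
| "run_lengths r s (Suc k) =
    (if k = 0 \<or> r (s + k) then run_lengths r s k @ [1]
     else butlast (run_lengths r s k) @ [Suc (last (run_lengths r s k))])"

lemma run_lengths_eq_Nil_iff [simp]: "run_lengths r s k = [] \<longleftrightarrow> k = 0"
  by (induction k) auto

text \<open>The last run begins at the last cut, and the default \<open>0\<close> of
  \<open>last_true\<close> matches the cut at \<open>s\<close>. Thus the exponent in
  \<open>dec_weight\<close> is the block length minus the last part, which is the contribution of
  the block to \<open>D_stat\<close>.\<close>

lemma last_run_lengths: "0 < k \<Longrightarrow> last (run_lengths r s k) = k - last_true r s k"
proof (induction k)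
  case (Suc k)
  then show ?case using last_true_less[of k r s] by (cases "k = 0") auto
qed simp

lemma run_lengths_in_compositions: "run_lengths r s k \<in> compositions k"
proof (induction k)
  case (Suc k)
  show ?case
  proof (cases "k = 0")
    case False
    then obtain a as where "run_lengths r s k = as @ [a]"
      by (metis rev_exhaust run_lengths_eq_Nil_iff)
    with Suc show ?thesis by (auto simp: compositions_def)
  qed (auto simp: compositions_def)
qed simp

text \<open>Whether there is a cut at \<open>s + k\<close> decides between the two ways to join:
  without it, the last run of the first interval continues into the second.\<close>

lemma run_lengths_add:
  assumes "0 < k" "0 < m"
  shows "run_lengths r s (k + m) =
    (if r (s + k) then run_lengths r s k @ run_lengths r (s + k) m
     else near_concat (run_lengths r s k) (run_lengths r (s + k) m))"
  using assms(2)
proof (induction m)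
  case (Suc m)
  show ?case
  proof (cases "m = 0")
    case True
    then show ?thesis using assms(1) by (simp add: near_concat_def)
  next
    case False
    obtain a as where a: "run_lengths r (s + k) m = a # as"
      using False by (cases "run_lengths r (s + k) m") auto
    show ?thesis
      using Suc.IH False assms(1) a
      by (cases "as = []") (simp_all add: near_concat_def add.assoc butlast_append)
  qed
qed simp

lemma run_lengths_cong: "(\<And>i. i < k \<Longrightarrow> r (s + i) = r' (s + i)) \<Longrightarrow> run_lengths r s k = run_lengths r' s k"
  by (induction k) auto

section \<open>Restriction of a composition to blocks\<close>

fun restrict_runs :: "(nat \<Rightarrow> bool) \<Rightarrow> nat \<Rightarrow> nat list \<Rightarrow> nat list list" where
  "restrict_runs r s [] = []"
| "restrict_runs r s (i # I) = run_lengths r s i # restrict_runs r (s + i) I"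

lemma is_restriction_restrict_runs:
  assumes "0 \<notin> set I" "I \<noteq> []"
  shows "is_restriction (run_lengths r s (sum_list I)) I (restrict_runs r s I)"
  using assms
proof (induction I arbitrary: s)
  case (Cons i I)
  show ?case
  proof (cases "I = []")
    case True
    then show ?thesis
      by (auto simp: is_restriction_def glued_Cons_iff run_lengths_in_compositions)
  next
    case False
    then have "0 < sum_list I" using Cons.prems by (cases I) auto
    moreover have "restrict_runs r (s + i) I \<noteq> []" using False by (cases I) auto
    moreover have "is_restriction (run_lengths r (s + i) (sum_list I)) I (restrict_runs r (s + i) I)"
      using Cons False by auto
    ultimately show ?thesis
      using Cons.prems
      by (auto simp: is_restriction_def glued_Cons_iff run_lengths_in_compositions run_lengths_add)
  qed
qed simp

text \<open>Uniqueness of the restriction evaluates the definite description: it suffices that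
  cutting every block of \<open>I\<close> where \<open>r\<close> holds yields a restriction.\<close>

lemma comp_restrict_run_lengths:
  assumes "I \<in> compositions n" "n \<ge> 1"
  shows "comp_restrict (run_lengths r s n) I = restrict_runs r s I"
proof -
  have "I \<noteq> []" using assms by (auto simp: compositions_def)
  then have "is_restriction (run_lengths r s n) I (restrict_runs r s I)"
    using is_restriction_restrict_runs[of I r s] assms(1) by (auto simp: compositions_def)
  then show ?thesis
    using ex1_restriction[OF assms(1) run_lengths_in_compositions assms(2), of r s]
    unfolding comp_restrict_def by (rule the1_equality[rotated])
qed

fun last_true_sum :: "(nat \<Rightarrow> bool) \<Rightarrow> nat \<Rightarrow> nat list \<Rightarrow> nat" where
  "last_true_sum r s [] = 0"
| "last_true_sum r s (i # I) = last_true r s i + last_true_sum r (s + i) I"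

text \<open>The additive form keeps the truncated subtraction of \<open>D_stat\<close> out of the
  induction.\<close>

lemma sum_last_restrict_runs:
  "0 \<notin> set I \<Longrightarrow> sum_list (map last (restrict_runs r s I)) + last_true_sum r s I = sum_list I"
proof (induction I arbitrary: s)
  case (Cons i I)
  then show ?case using last_true_less[of i r s] Cons.IH[of "s + i"] by (auto simp: last_run_lengths)
qed simp

lemma D_stat_run_lengths:
  assumes "I \<in> compositions n" "n \<ge> 1"
  shows "D_stat I (run_lengths r s n) = last_true_sum r s I"
  using sum_last_restrict_runs[of I r s] assms
  by (auto simp: D_stat_def comp_restrict_run_lengths compositions_def)

section \<open>Descent sets of compositions\<close>

lemma Des_Nil [simp]: "Des [] = {}"
  by (simp add: Des_def)

lemma Des_Cons: "Des (i # I) = (if I = [] then {} else insert i ((+) i ` Des I))"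
proof (cases "I = []")
  case False
  show ?thesis
  proof (intro set_eqI iffI)
    fix x assume "x \<in> Des (i # I)"
    then obtain k where k: "1 \<le> k" "k < Suc (length I)" "x = sum_list (take k (i # I))"
      by (auto simp: Des_def)
    then show "x \<in> (if I = [] then {} else insert i ((+) i ` Des I))"
      using False by (cases k; cases "k = 1") (auto simp: Des_def image_iff)
  next
    fix x assume "x \<in> (if I = [] then {} else insert i ((+) i ` Des I))"
    with False consider "x = i" | k where "1 \<le> k" "k < length I" "x = i + sum_list (take k I)"
      by (auto simp: Des_def)
    then show "x \<in> Des (i # I)"
    proof cases
      case 1
      then show ?thesis using False by (auto simp: Des_def intro!: exI[of _ 1])
    next
      case 2
      then show ?thesis by (auto simp: Des_def intro!: exI[of _ "Suc k"])
    qed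
  qed
qed (auto simp: Des_def)

lemma zero_notin_Des: "0 \<notin> set I \<Longrightarrow> 0 \<notin> Des I"
  by (induction I) (auto simp: Des_Cons split: if_splits)

text \<open>The complement of \<open>Des (i # I)\<close> consists of the positions inside the parts,
  so descents there mean that every block decreases. A member \<open>p\<close> of \<open>Des\<close>
  separates the letters \<open>p - 1\<close> and \<open>p\<close> counted from zero, whence
  \<open>d (s + p - 1)\<close>.\<close>

lemma compl_Des_descents_Cons:
  assumes "i # I \<in> compositions n"
  shows "(\<forall>p\<in>{1..<n} - Des (i # I). d (s + p - 1)) \<longleftrightarrow>
    decr d s (s + i) \<and> (\<forall>p\<in>{1..<n - i} - Des I. d (s + i + p - 1))"
proof -
  have i: "0 < i" "I \<in> compositions (n - i)" "i \<le> n"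
    using assms by (auto simp: Cons_in_compositions_iff)
  have mem: "p \<in> Des (i # I) \<longleftrightarrow> I \<noteq> [] \<and> (p = i \<or> i < p \<and> p - i \<in> Des I)" for p
  proof -
    have "0 \<notin> Des I" using i zero_notin_Des[of I] by (simp add: compositions_def)
    then have "p \<in> (+) i ` Des I \<longleftrightarrow> i < p \<and> p - i \<in> Des I"
      by (auto intro!: image_eqI[of _ _ "p - i"] intro: gr0I)
    then show ?thesis by (simp add: Des_Cons)
  qed
  \<comment> \<open>The position \<open>i\<close> belongs to \<open>Des (i # I)\<close> unless
    \<open>i\<close> is the only part, and then \<open>i = n\<close> is out of range.\<close>
  have eq: "I = [] \<longleftrightarrow> n = i"
  proof
    assume "n = i" with i show "I = []" by simp
  qed (use i in \<open>auto simp: compositions_def\<close>)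
  show ?thesis
  proof (intro iffI conjI ballI)
    assume *: "\<forall>p\<in>{1..<n} - Des (i # I). d (s + p - 1)"
    show "decr d s (s + i)"
      unfolding decr_def
    proof (intro allI impI)
      fix k assume k: "s \<le> k \<and> Suc k < s + i"
      have "Suc k - s \<in> {1..<n} - Des (i # I)" using k i(1,3) mem[of "Suc k - s"] by auto
      with * have "d (s + (Suc k - s) - 1)" by blast
      with k show "d k" by simp
    qed
    fix p assume p: "p \<in> {1..<n - i} - Des I"
    then have "i + p \<in> {1..<n} - Des (i # I)" using mem[of "i + p"] by auto
    with * have "d (s + (i + p) - 1)" by blast
    then show "d (s + i + p - 1)" by (simp add: add.assoc)
  next
    fix p assume *: "decr d s (s + i) \<and> (\<forall>p\<in>{1..<n - i} - Des I. d (s + i + p - 1))"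
      and p: "p \<in> {1..<n} - Des (i # I)"
    show "d (s + p - 1)"
    proof (cases "p < i")
      case True
      then show ?thesis using * p by (auto simp: decr_def)
    next
      case False
      with p mem[of p] eq have "i < p" by auto
      with p mem[of p] eq have "p - i \<in> {1..<n - i} - Des I" by auto
      with * have "d (s + i + (p - i) - 1)" by blast
      then show ?thesis using \<open>i < p\<close> by simp
    qed
  qed
qed

lemma path_prod_dec_weight:
  assumes "I \<in> compositions n"
  shows "path_prod (dec_weight q r d) s I =
    (if \<forall>p\<in>{1..<n} - Des I. d (s + p - 1)
     then (-1) ^ (n - length I) * q ^ last_true_sum r s I else 0)"
  using assms
proof (induction I arbitrary: n s)
  case Nil
  then show ?case by (auto simp: compositions_def)
next
  case (Cons i I)
  then have i: "0 < i" "I \<in> compositions (n - i)" "i \<le> n"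
    by (auto simp: Cons_in_compositions_iff)
  \<comment> \<open>The sign splits over the blocks because \<open>n - l(I)\<close> is the sum of
    all \<open>i - 1\<close>; no subtraction is truncated, as a composition has at most as many
    parts as its size.\<close>
  have "n - length (i # I) = (i - 1) + (n - i - length I)"
    using length_le_composition[OF i(2)] i by simp
  then have pw: "(-1) ^ (n - length (i # I)) = (-1) ^ (i - 1) * ((-1) ^ (n - i - length I) :: 'a)"
    by (metis power_add)
  show ?case
    unfolding compl_Des_descents_Cons[OF Cons.prems] pw path_prod.simps Cons.IH[OF i(2)]
    by (auto simp: dec_weight_def power_add algebra_simps)
qed

section \<open>Descent compositions of words\<close>

lemma increasing_runs_eq_Nil_iff [simp]: "increasing_runs xs = [] \<longleftrightarrow> xs = []"
  by (cases xs) (auto split: list.splits)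

lemma concat_increasing_runs [simp]: "concat (increasing_runs xs) = xs"
  by (induction xs) (auto split: list.splits)

lemma Nil_notin_increasing_runs: "[] \<notin> set (increasing_runs xs)"
  by (induction xs) (auto split: list.splits)

lemma descent_comp_in_compositions: "descent_comp xs \<in> compositions (length xs)"
proof -
  have "sum_list (descent_comp xs) = length (concat (increasing_runs xs))"
    by (simp only: descent_comp_def length_concat)
  then show ?thesis
    using Nil_notin_increasing_runs[of xs] by (auto simp: compositions_def descent_comp_def)
qed

text \<open>A run ends where the next letter is not larger, which for distinct letters is a descent.
  Prepending a letter shifts all positions by one and decides only position
  \<open>1\<close>.\<close>

lemma Des_descent_comp:
  assumes "distinct xs"
  shows "Des (descent_comp xs) = {p. 1 \<le> p \<and> p < length xs \<and> xs ! (p - 1) > xs ! p}"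
  using assms
proof (induction xs)
  case (Cons x xs)
  show ?case
  proof (cases xs)
    case Nil
    then show ?thesis by (auto simp: descent_comp_def Des_Cons)
  next
    case (Cons y ys)
    obtain r rs where r: "increasing_runs xs = r # rs"
      using Cons by (metis increasing_runs_eq_Nil_iff list.distinct(1) list.exhaust)
    have "r \<noteq> []" using Nil_notin_increasing_runs[of xs] r by auto
    moreover have "r @ concat rs = xs" using concat_increasing_runs[of xs] r by simp
    ultimately have hd: "hd r = y" using Cons by (cases r) auto
    have IH: "Des (length r # map length rs) = {p. 1 \<le> p \<and> p < length xs \<and> xs ! (p - 1) > xs ! p}"
      using Cons.IH Cons.prems r by (simp add: descent_comp_def)
    have shift: "{p. 1 \<le> p \<and> p < length (x # xs) \<and> (x # xs) ! (p - 1) > (x # xs) ! p} =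
      (if x > y then {1} else {}) \<union> Suc ` {p. 1 \<le> p \<and> p < length xs \<and> xs ! (p - 1) > xs ! p}" (is "?A = ?B")
    proof (intro set_eqI iffI)
      fix p assume "p \<in> ?A"
      then show "p \<in> ?B" using Cons by (cases p; cases "p - 1") (auto simp: image_iff)
    qed (use Cons in \<open>auto split: if_splits simp: nth_Cons'\<close>)
    have ne: "x \<noteq> y" using Cons.prems Cons by auto
    show ?thesis
    proof (cases "x < y")
      case True
      then show ?thesis
        unfolding shift IH[symmetric] using r hd by (auto simp: descent_comp_def Des_Cons image_image)
    next
      case False
      then show ?thesis
        unfolding shift IH[symmetric] using r hd ne
        by (auto simp: descent_comp_def Des_Cons[of "Suc 0"])
    qed
  qed
qed (simp add: descent_comp_def)

section \<open>Records and dominated factorizations\<close>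

definition is_record :: "nat list \<Rightarrow> nat \<Rightarrow> bool" where
  "is_record c p \<longleftrightarrow> (\<forall>i<p. c ! i < c ! p)"

lemma initially_dominated_le_hd: "initially_dominated w \<Longrightarrow> x \<in> set w \<Longrightarrow> x \<le> hd w"
  by (cases w) (auto simp: initially_dominated_def)

text \<open>Induction on the last letter \<open>x\<close>. A new maximum opens a factor of its own.
  Otherwise some earlier letter exceeds \<open>x\<close>, hence so does the first letter of the last
  factor, which is the maximum of the prefix, and \<open>x\<close> joins that factor.\<close>

lemma ex_dominated_factorization_run_lengths:
  "distinct c \<Longrightarrow> \<exists>us. is_dominated_factorization us c \<and> map length us = run_lengths (is_record c) 0 (length c)"
proof (induction c rule: rev_induct)
  case Nil
  then show ?case by (auto simp: is_dominated_factorization_def)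
next
  case (snoc x c)
  then obtain us where us: "is_dominated_factorization us c"
    "map length us = run_lengths (is_record c) 0 (length c)" by auto
  have cong: "run_lengths (is_record (c @ [x])) 0 (length c) = run_lengths (is_record c) 0 (length c)"
    by (rule run_lengths_cong) (auto simp: is_record_def nth_append)
  have rec: "is_record (c @ [x]) (length c) \<longleftrightarrow> (\<forall>y\<in>set c. y < x)"
    by (auto simp: is_record_def nth_append all_set_conv_all_nth)
  show ?case
  proof (cases "\<forall>y\<in>set c. y < x")
    case True
    have "hd u \<le> x" if "u \<in> set us" for u
    proof -
      have "u \<noteq> []" using that us by (auto simp: is_dominated_factorization_def initially_dominated_def)
      then have "hd u \<in> set (concat us)" using that by (auto intro!: bexI[of _ u])
      then have "hd u \<in> set c" using us(1) unfolding is_dominated_factorization_def by metis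
      then show ?thesis using True by auto
    qed
    then have "is_dominated_factorization (us @ [[x]]) (c @ [x])"
      using us by (auto simp: is_dominated_factorization_def initially_dominated_def sorted_append)
    moreover have "map length (us @ [[x]]) = run_lengths (is_record (c @ [x])) 0 (length (c @ [x]))"
      using us rec True by (simp add: cong)
    ultimately show ?thesis by blast
  next
    case False
    then have "c \<noteq> []" by auto
    then have "us \<noteq> []" using us by (auto simp: is_dominated_factorization_def)
    then obtain vs v where v: "us = vs @ [v]" by (cases us rule: rev_cases) auto
    have dom: "\<forall>w\<in>set us. initially_dominated w" and srt: "sorted (map hd us)"
      and cat: "concat us = c" using us by (auto simp: is_dominated_factorization_def)
    have "v \<noteq> []" using dom v by (auto simp: initially_dominated_def)
    obtain y where y: "y \<in> set c" "x \<le> y" using False by (auto simp: not_less)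
    then have "x < y" using snoc.prems by (cases "x = y") auto
    moreover obtain w where w: "w \<in> set us" "y \<in> set w" using y cat by auto
    have "y \<le> hd w" using w dom initially_dominated_le_hd by auto
    moreover have "hd w \<le> hd v" using w srt v by (auto simp: sorted_append)
    ultimately have "x < hd v" by linarith
    then have "is_dominated_factorization (vs @ [v @ [x]]) (c @ [x])"
      using us v \<open>v \<noteq> []\<close> by (auto simp: is_dominated_factorization_def initially_dominated_def sorted_append)
    moreover have "map length (vs @ [v @ [x]]) = run_lengths (is_record (c @ [x])) 0 (length (c @ [x]))"
      using us(2)[symmetric] v rec False \<open>c \<noteq> []\<close> by (simp add: cong)
    ultimately show ?thesis by blast
  qed
qed

lemma is_dominated_factorization_the:
  "is_dominated_factorization us c \<longleftrightarrow> us = dominated_factorization c"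
  using the1_equality[OF ex1_dominated_factorization] theI'[OF ex1_dominated_factorization]
  unfolding dominated_factorization_def by metis

lemma saillance_comp_run_lengths:
  "distinct c \<Longrightarrow> saillance_comp c = run_lengths (is_record c) 0 (length c)"
  using ex_dominated_factorization_run_lengths[of c]
  by (auto simp: saillance_comp_def is_dominated_factorization_the)

section \<open>Expansion of the iterated brackets\<close>

lemma lookup_smult [simp]: "Poly_Mapping.lookup (smult c F) x = c * Poly_Mapping.lookup F x"
  by (simp add: smult_def map.rep_eq when_def)

lemma smult_0_left [simp]: "smult 0 F = 0"
  and smult_0_right [simp]: "smult c 0 = 0"
  and smult_1_left [simp]: "smult 1 F = F"
  and smult_add_left: "smult (a + b) F = smult a F + smult b F"
  and smult_add_right: "smult a (F + G) = smult a F + smult a G"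
  and smult_smult: "smult a (smult b F) = smult (a * b) F"
  and smult_minus_left: "smult (- a) F = - smult a F"
  by (rule poly_mapping_eqI; simp add: lookup_add algebra_simps)+

lemma smult_sum_right: "smult a (sum f A) = (\<Sum>x\<in>A. smult a (f x))"
  by (induction A rule: infinite_finite_induct) (simp_all add: smult_add_right)

lemma linear_ext_superset:
  assumes "finite A" "Poly_Mapping.keys F \<subseteq> A"
  shows "linear_ext f F = (\<Sum>x\<in>A. smult (Poly_Mapping.lookup F x) (f x))"
  unfolding linear_ext_def
  by (rule sum.mono_neutral_left) (use assms in \<open>auto simp: in_keys_iff\<close>)

lemma linear_ext_add: "linear_ext f (F + G) = linear_ext f F + linear_ext f G"
proof -
  let ?A = "Poly_Mapping.keys F \<union> Poly_Mapping.keys G"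
  have "linear_ext f H = (\<Sum>x\<in>?A. smult (Poly_Mapping.lookup H x) (f x))"
    if "H \<in> {F, G, F + G}" for H
    using that Poly_Mapping.keys_add[of F G] by (intro linear_ext_superset) auto
  then show ?thesis by (simp add: lookup_add smult_add_left sum.distrib)
qed

lemma linear_ext_smult: "linear_ext f (smult a F) = smult a (linear_ext f F)"
proof -
  have "Poly_Mapping.keys (smult a F) \<subseteq> Poly_Mapping.keys F" by (auto simp: in_keys_iff)
  then show ?thesis
    by (subst linear_ext_superset[of "Poly_Mapping.keys F"])
      (auto simp: linear_ext_def smult_sum_right smult_smult)
qed

lemma linear_ext_0 [simp]: "linear_ext f 0 = 0"
  by (simp add: linear_ext_def)

lemma linear_ext_sum: "linear_ext f (sum F A) = (\<Sum>x\<in>A. linear_ext f (F x))"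
  by (induction A rule: infinite_finite_induct) (simp_all add: linear_ext_add)

lemma linear_ext_single [simp]: "linear_ext f (Poly_Mapping.single x 1) = f x"
proof -
  have "linear_ext f (Poly_Mapping.single x 1) =
      (\<Sum>y\<in>{x}. smult (Poly_Mapping.lookup (Poly_Mapping.single x 1) y) (f y))"
    by (rule linear_ext_superset) (auto split: if_splits)
  then show ?thesis by simp
qed

lemma lookup_linear_ext:
  "Poly_Mapping.lookup (linear_ext f F) y =
    (\<Sum>x\<in>Poly_Mapping.keys F. Poly_Mapping.lookup F x * Poly_Mapping.lookup (f x) y)"
  by (simp add: linear_ext_def lookup_sum)

lemma lookup_biw:
  "Poly_Mapping.lookup (biw u \<alpha>) (v, \<beta>) = (if u = v \<and> \<alpha> = \<beta> then 1 else 0)"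
  by (simp add: biw_def lookup_single when_def)

text \<open>The words in the expansion of the iterated bracket: every letter after the first goes to
  the right end with coefficient \<open>1\<close> or to the left end with \<open>- q\<close>.
  \<open>S\<close> holds the letters that went left; they appear in reverse order.\<close>

definition valley :: "'a set \<Rightarrow> 'a \<Rightarrow> 'a list \<Rightarrow> 'a list" where
  "valley S j js = rev (filter (\<lambda>x. x \<in> S) js) @ j # filter (\<lambda>x. x \<notin> S) js"

lemma valley_snoc:
  assumes "b \<notin> S" "b \<notin> set js"
  shows "valley S j (js @ [b]) = valley S j js @ [b]"
    and "valley (insert b S) j (js @ [b]) = b # valley S j js"
proof -
  have "filter (\<lambda>x. x \<in> insert b S) js = filter (\<lambda>x. x \<in> S) js"
    "filter (\<lambda>x. x \<notin> insert b S) js = filter (\<lambda>x. x \<notin> S) js"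
    using assms by (auto intro!: filter_cong)
  then show "valley (insert b S) j (js @ [b]) = b # valley S j js"
    by (simp add: valley_def)
qed (use assms in \<open>simp add: valley_def\<close>)

lemma iterated_bracket_eq_sum_valley:
  assumes "distinct js"
  shows "iterated_bracket q (map f (j # js)) =
    (\<Sum>S\<in>Pow (set js). smult ((- q) ^ card S) (Poly_Mapping.single (map f (valley S j js)) 1))"
  using assms
proof (induction js rule: rev_induct)
  case Nil
  then show ?case by (simp add: biletter_def valley_def)
next
  case (snoc b js)
  let ?g = "\<lambda>S js. smult ((- q) ^ card S) (Poly_Mapping.single (map f (valley S j js)) 1)"
  let ?B = "iterated_bracket q (map f (j # js))"
  have b: "b \<notin> set js" and IH: "?B = (\<Sum>S\<in>Pow (set js). ?g S js)"
    using snoc by auto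
  have "iterated_bracket q (map f (j # js @ [b])) = q_bracket q ?B (biletter (f b))"
    by simp
  also have "\<dots> = linear_ext (\<lambda>w. Poly_Mapping.single (w @ [f b]) 1) ?B
      + smult (- q) (linear_ext (\<lambda>w. Poly_Mapping.single (f b # w) 1) ?B)"
    by (simp add: q_bracket_def conc_mult_def bilinear_ext_def biletter_def smult_minus_left
        del: iterated_bracket.simps)
  also have "linear_ext (\<lambda>w. Poly_Mapping.single (w @ [f b]) 1) ?B = (\<Sum>S\<in>Pow (set js). ?g S (js @ [b]))"
    unfolding IH linear_ext_sum linear_ext_smult linear_ext_single
  proof (rule sum.cong[OF refl])
    fix S assume "S \<in> Pow (set js)"
    then have "b \<notin> S" using b by auto
    then show "smult ((- q) ^ card S) (Poly_Mapping.single (map f (valley S j js) @ [f b]) 1) = ?g S (js @ [b])"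
      using b by (simp add: valley_snoc)
  qed
  also have "smult (- q) (linear_ext (\<lambda>w. Poly_Mapping.single (f b # w) 1) ?B) =
      (\<Sum>S\<in>Pow (set js). ?g (insert b S) (js @ [b]))"
    unfolding IH linear_ext_sum linear_ext_smult linear_ext_single smult_sum_right
  proof (rule sum.cong[OF refl])
    fix S assume S: "S \<in> Pow (set js)"
    then have "b \<notin> S" "finite S" using b by (auto dest: finite_subset)
    then show "smult (- q) (smult ((- q) ^ card S) (Poly_Mapping.single (f b # map f (valley S j js)) 1))
        = ?g (insert b S) (js @ [b])"
      using b by (simp add: valley_snoc smult_smult)
  qed
  also have "\<dots> = (\<Sum>S\<in>insert b ` Pow (set js). ?g S (js @ [b]))"
    by (subst sum.reindex) (use b in \<open>auto simp: inj_on_def\<close>)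
  \<comment> \<open>Subsets without \<open>b\<close> stem from multiplication by \<open>b\<close> on
    the right, those with \<open>b\<close> from multiplication on the left.\<close>
  also have "(\<Sum>S\<in>Pow (set js). ?g S (js @ [b])) + (\<Sum>S\<in>insert b ` Pow (set js). ?g S (js @ [b])) =
      (\<Sum>S\<in>Pow (set (js @ [b])). ?g S (js @ [b]))"
    by (subst sum.union_disjoint[symmetric]) (use b in \<open>auto simp: Pow_insert\<close>)
  finally show ?case .
qed

lemma Psi_eq_sum_valley:
  assumes "u \<noteq> []"
  shows "Psi q u = (\<Sum>S\<in>Pow {2..length u}. let w = valley S 1 [2..<Suc (length u)] in
    smult ((- q) ^ card S) (biw (map (\<lambda>j. u ! (j - 1)) w) w))"
proof -
  let ?f = "\<lambda>j. (u ! (j - 1), j)"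
  have zip: "zip u [1..<Suc (length u)] = map ?f [1..<Suc (length u)]"
    by (rule nth_equalityI) (simp_all del: upt_Suc)
  have "[1..<Suc (length u)] = 1 # [2..<Suc (length u)]"
    using assms by (subst upt_conv_Cons) (auto simp: Suc_le_eq numeral_2_eq_2)
  then have z: "zip u [1..<Suc (length u)] = map ?f (1 # [2..<Suc (length u)])"
    using zip by simp
  have "set [2..<Suc (length u)] = {2..length u}" by auto
  then show ?thesis
    unfolding Psi_def z iterated_bracket_eq_sum_valley[OF distinct_upt] linear_ext_sum linear_ext_smult
    by (simp only: linear_ext_single map_map o_def fst_conv snd_conv Let_def map_ident)
qed

lemma lookup_Psi:
  assumes "u \<noteq> []"
  shows "Poly_Mapping.lookup (Psi q u) (x, \<pi>) =
    (\<Sum>S\<in>Pow {2..length u}. if \<pi> = valley S 1 [2..<Suc (length u)] \<and> x = map (\<lambda>j. u ! (j - 1)) \<pi>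
      then (- q) ^ card S else 0)"
  unfolding Psi_eq_sum_valley[OF assms] lookup_sum
  by (intro sum.cong) (auto simp: Let_def lookup_biw)

section \<open>Permutations with a single valley\<close>

definition is_descent :: "nat list \<Rightarrow> nat \<Rightarrow> bool" where
  "is_descent w i \<longleftrightarrow> w ! i > w ! Suc i"

lemma decr_iff_sorted_wrt:
  assumes "p < length w"
  shows "decr (is_descent w) 0 (Suc p) \<longleftrightarrow> sorted_wrt (>) (take (Suc p) w)"
proof -
  have "sorted_wrt (>) (take (Suc p) w) \<longleftrightarrow> (\<forall>i. Suc i < Suc p \<longrightarrow> w ! i > w ! Suc i)"
    using assms by (subst sorted_wrt_iff_nth_Suc_transp) auto
  then show ?thesis by (simp add: decr_def is_descent_def)
qed

lemma incr_iff_sorted_wrt: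
  assumes "p < length w" "distinct w"
  shows "incr (is_descent w) p (length w) \<longleftrightarrow> sorted_wrt (<) (drop p w)"
proof -
  have "sorted_wrt (<) (drop p w) \<longleftrightarrow> (\<forall>i. Suc i < length w - p \<longrightarrow> w ! (p + i) < w ! Suc (p + i))"
    by (subst sorted_wrt_iff_nth_Suc_transp) auto
  also have "\<dots> \<longleftrightarrow> (\<forall>i. p \<le> i \<and> Suc i < length w \<longrightarrow> w ! i < w ! Suc i)"
    (is "?l \<longleftrightarrow> ?r")
  proof
    assume l: ?l
    show ?r
    proof (intro allI impI)
      fix i assume "p \<le> i \<and> Suc i < length w"
      then show "w ! i < w ! Suc i" using l[rule_format, of "i - p"] by auto
    qed
  qed auto
  also have "\<dots> \<longleftrightarrow> incr (is_descent w) p (length w)"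
  proof -
    have "w ! i < w ! Suc i \<longleftrightarrow> \<not> is_descent w i" if "Suc i < length w" for i
      using that assms(2) nth_eq_iff_index_eq[of w i "Suc i"] by (auto simp: is_descent_def)
    then show ?thesis by (auto simp: incr_def)
  qed
  finally show ?thesis ..
qed

text \<open>A permutation that decreases and then increases is determined by the set of letters left
  of its minimum, and this set is \<open>S\<close>. The minimum \<open>1\<close> therefore stands at
  the zero-based position \<open>card S\<close>.\<close>

lemma eq_valley_iff:
  assumes \<pi>: "\<pi> \<in> permutations_of_set {1..k}" and k: "0 < k" and S: "S \<subseteq> {2..k}"
  shows "\<pi> = valley S 1 [2..<Suc k] \<longleftrightarrow>
    card S < k \<and> S = set (take (card S) \<pi>) \<and>
    decr (is_descent \<pi>) 0 (Suc (card S)) \<and> incr (is_descent \<pi>) (card S) k"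
proof -
  let ?js = "[2..<Suc k]" and ?p = "card S"
  let ?A = "filter (\<lambda>x. x \<in> S) ?js" and ?B = "filter (\<lambda>x. x \<notin> S) ?js"
  have set\<pi>: "set \<pi> = {1..k}" and dist: "distinct \<pi>" and len: "length \<pi> = k"
    using \<pi> by (auto simp: permutations_of_set_def distinct_card[symmetric])
  have A: "set ?A = S" and B: "set ?B = {2..k} - S" using S by auto
  have srt: "sorted_wrt (<) ?A" "sorted_wrt (<) ?B"
    by (intro sorted_wrt_filter sorted_wrt_upt)+
  have lenA: "length ?A = ?p"
    using distinct_card[of ?A] A by simp
  have "card S \<le> card {2..k}" using S by (intro card_mono) auto
  then have pk: "?p < k" using k by simp
  show ?thesis
    unfolding decr_iff_sorted_wrt[OF pk[folded len]] incr_iff_sorted_wrt[OF pk[folded len] dist, unfolded len]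
  proof (intro iffI conjI)
    assume *: "\<pi> = valley S 1 ?js"
    have t: "take ?p \<pi> = rev ?A" "take (Suc ?p) \<pi> = rev (1 # ?A)" "drop ?p \<pi> = 1 # ?B"
      using lenA unfolding * by (auto simp: valley_def)
    show "?p < k" by (rule pk)
    show "S = set (take ?p \<pi>)" unfolding t using A by simp
    show "sorted_wrt (>) (take (Suc ?p) \<pi>)"
      unfolding t sorted_wrt_rev using srt A S by (auto simp: Suc_le_eq)
    show "sorted_wrt (<) (drop ?p \<pi>)"
      unfolding t using srt B by auto
  next
    assume *: "?p < k \<and> S = set (take ?p \<pi>) \<and> sorted_wrt (>) (take (Suc ?p) \<pi>) \<and> sorted_wrt (<) (drop ?p \<pi>)"
    define A' a B' where "A' = take ?p \<pi>" and "a = \<pi> ! ?p" and "B' = drop (Suc ?p) \<pi>"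
    have split: "\<pi> = A' @ a # B'" "take (Suc ?p) \<pi> = A' @ [a]" "drop ?p \<pi> = a # B'"
      using pk len by (auto simp: A'_def a_def B'_def id_take_nth_drop take_Suc_conv_app_nth Cons_nth_drop_Suc)
    have "sorted_wrt (>) (A' @ [a])" "sorted_wrt (<) (a # B')"
      using * split(2,3) by simp_all
    then have less: "\<forall>x\<in>set A' \<union> set B'. a < x" and srt': "sorted_wrt (<) (rev A')" "sorted_wrt (<) B'"
      by (auto simp: sorted_wrt_append sorted_wrt_rev)
    have "set A' \<union> {a} \<union> set B' = {1..k}" using set\<pi> split(1) by auto
    moreover from this have "a \<ge> 1" "1 \<in> set A' \<union> {a} \<union> set B'" using k by auto
    \<comment> \<open>The letter at the turning point is below all others, and \<open>1\<close>
      occurs.\<close>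
    ultimately have a: "a = 1" using less by force
    have A': "set (rev A') = S" using * by (simp add: A'_def)
    moreover have "set A' \<inter> set B' = {}" "a \<notin> set B'" using dist split(1) by auto
    ultimately have "set B' = {1..k} - {1} - S"
      using \<open>set A' \<union> {a} \<union> set B' = {1..k}\<close> a by auto
    also have "{1..k} - {1} = {2..k}" by auto
    finally have B': "set B' = {2..k} - S" .
    \<comment> \<open>A strictly increasing list is determined by its set.\<close>
    have "rev A' = ?A" by (rule strict_sorted_equal) (use srt srt' A A' in auto)
    then have "A' = rev ?A" by (metis rev_rev_ident)
    moreover have "B' = ?B" by (rule strict_sorted_equal) (use srt srt' B B' in auto)
    ultimately show "\<pi> = valley S 1 ?js" using split(1) a by (simp add: valley_def)
  qed
qed

section \<open>Standardization and one block\<close>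

lemma length_std [simp]: "length (std w) = length w"
  by (simp add: std_def)

lemma nth_std:
  "i < length w \<Longrightarrow> distinct w \<Longrightarrow> std w ! i = card {j. j < length w \<and> w ! j \<le> w ! i}"
  unfolding std_def by (auto intro!: arg_cong[of _ _ card] simp: nth_eq_iff_index_eq)

lemma std_nth_less_iff:
  assumes "distinct w" "i < length w" "j < length w"
  shows "std w ! i < std w ! j \<longleftrightarrow> w ! i < w ! j"
proof -
  have mono: "std w ! i < std w ! j" if "w ! i < w ! j" "i < length w" "j < length w" for i j
    unfolding nth_std[OF that(2) assms(1)] nth_std[OF that(3) assms(1)]
  proof (rule psubset_card_mono)
    show "{k. k < length w \<and> w ! k \<le> w ! i} \<subset> {k. k < length w \<and> w ! k \<le> w ! j}"
    proof
      show "{k. k < length w \<and> w ! k \<le> w ! i} \<subseteq> {k. k < length w \<and> w ! k \<le> w ! j}"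
        using that(1) by fastforce
      have "j \<notin> {k. k < length w \<and> w ! k \<le> w ! i}" "j \<in> {k. k < length w \<and> w ! k \<le> w ! j}"
        using that by simp_all
      then show "{k. k < length w \<and> w ! k \<le> w ! i} \<noteq> {k. k < length w \<and> w ! k \<le> w ! j}"
        by blast
    qed
  qed simp
  show ?thesis
  proof
    assume l: "std w ! i < std w ! j"
    show "w ! i < w ! j"
    proof (rule ccontr)
      assume "\<not> w ! i < w ! j"
      then have "w ! j < w ! i \<or> i = j"
        using assms by (metis linorder_neqE_nat nth_eq_iff_index_eq)
      then show False using mono[of j i] l assms by auto
    qed
  qed (use mono assms in auto)
qed

lemma std_in_permutations:
  assumes "distinct w"
  shows "std w \<in> permutations_of_set {1..length w}"
proof -
  have "distinct (std w)"
    unfolding distinct_conv_nth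
  proof (intro allI impI)
    fix i j assume "i < length (std w)" "j < length (std w)" "i \<noteq> j"
    then have "i < length w" "j < length w" "w ! i \<noteq> w ! j"
      using assms by (auto simp: nth_eq_iff_index_eq)
    then show "std w ! i \<noteq> std w ! j"
      using std_nth_less_iff[OF assms, of i j] std_nth_less_iff[OF assms, of j i] by auto
  qed
  moreover have "set (std w) \<subseteq> {1..length w}"
  proof
    fix x assume "x \<in> set (std w)"
    then obtain i where i: "i < length w" "x = std w ! i" by (auto simp: in_set_conv_nth)
    have "card {i} \<le> x" "x \<le> card {..<length w}"
      unfolding i(2) nth_std[OF i(1) assms] by (rule card_mono; use i in auto)+
    then show "x \<in> {1..length w}" by simp
  qed
  ultimately show ?thesis
    using card_subset_eq[of "{1..length w}" "set (std w)"] distinct_card[of "std w"]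
    by (simp add: permutations_of_set_def)
qed

lemma std_eqI:
  assumes "length v = length w" "distinct v" "distinct w"
    and "\<And>i j. i < length w \<Longrightarrow> j < length w \<Longrightarrow> v ! i < v ! j \<longleftrightarrow> w ! i < w ! j"
  shows "std v = std w"
proof (rule nth_equalityI)
  fix i assume "i < length (std v)"
  then have i: "i < length v" "i < length w" using assms by auto
  have "v ! j \<le> v ! i \<longleftrightarrow> w ! j \<le> w ! i" if "j < length w" for j
    using assms(4)[OF i(2) that] by (auto simp: not_less[symmetric])
  then show "std v ! i = std w ! i"
    unfolding nth_std[OF i(1) assms(2)] nth_std[OF i(2) assms(3)]
    using assms(1) by (auto intro!: arg_cong[of _ _ card])
qed (use assms in simp)

lemma distinct_std: "distinct w \<Longrightarrow> distinct (std w)"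
  using std_in_permutations[of w] by (auto simp: permutations_of_set_def)

text \<open>Standardization keeps the order of every pair of positions, and the standardization of a
  factor depends on nothing else.\<close>

lemma std_take_std: "distinct w \<Longrightarrow> std (take a (std w)) = std (take a w)"
  by (rule std_eqI) (auto simp: std_nth_less_iff distinct_std)

lemma std_drop_std: "distinct w \<Longrightarrow> std (drop a (std w)) = std (drop a w)"
  by (rule std_eqI) (auto simp: std_nth_less_iff distinct_std)

lemma permutations_of_atLeastAtMostD:
  assumes "w \<in> permutations_of_set {1..n}"
  shows "length w = n" "distinct w" "set w = {1..n}"
  using assms by (auto simp: permutations_of_set_def distinct_card[symmetric])

text \<open>As every element of \<open>{1..n}\<close> occurs once, exactly \<open>w ! i\<close>
  letters are at most \<open>w ! i\<close>.\<close>

lemma std_permutation: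
  assumes "w \<in> permutations_of_set {1..n}"
  shows "std w = w"
proof (rule nth_equalityI)
  note w = permutations_of_atLeastAtMostD[OF assms]
  fix i assume "i < length (std w)"
  then have i: "i < length w" by simp
  have "bij_betw (\<lambda>j. w ! j) {j. j < length w \<and> w ! j \<le> w ! i} {1..w ! i}"
    unfolding bij_betw_def
  proof
    show "inj_on ((!) w) {j. j < length w \<and> w ! j \<le> w ! i}"
      using w by (auto simp: inj_on_def nth_eq_iff_index_eq)
    have "w ! i \<le> n" using nth_mem[OF i] w by auto
    show "(!) w ` {j. j < length w \<and> w ! j \<le> w ! i} = {1..w ! i}"
    proof (intro equalityI subsetI)
      fix x assume "x \<in> {1..w ! i}"
      then have "x \<in> set w" using w \<open>w ! i \<le> n\<close> by auto
      then obtain j where "j < length w" "x = w ! j" by (auto simp: in_set_conv_nth)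
      then show "x \<in> (!) w ` {j. j < length w \<and> w ! j \<le> w ! i}"
        using \<open>x \<in> {1..w ! i}\<close> by auto
    next
      fix x assume "x \<in> (!) w ` {j. j < length w \<and> w ! j \<le> w ! i}"
      then obtain j where j: "j < length w" "w ! j \<le> w ! i" "x = w ! j" by auto
      then show "x \<in> {1..w ! i}" using nth_mem[OF j(1)] w by auto
    qed
  qed
  then show "std w ! i = w ! i"
    using nth_std[OF i w(2)] by (auto dest!: bij_betw_same_card)
qed simp

section \<open>The coefficient contributed by one block\<close>

definition dominated_words :: "nat set \<Rightarrow> nat \<Rightarrow> nat set \<Rightarrow> nat list set" where
  "dominated_words N k X =
    {u. length u = k \<and> set u \<subseteq> N \<and> initially_dominated u \<and> (\<forall>z\<in>X. z < hd u)}"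

lemma finite_dominated_words: "finite N \<Longrightarrow> finite (dominated_words N k X)"
  by (rule finite_subset[OF _ finite_lists_length_eq[of N k]]) (auto simp: dominated_words_def)

text \<open>In a term of \<open>Psi q u\<close> the top row is \<open>u\<close> read in the order of
  the bottom row; this recovers \<open>u\<close> from the two rows.\<close>

lemma ex_map_permutation_eq:
  assumes \<pi>: "\<pi> \<in> permutations_of_set {1..k}" and x: "length x = k"
  obtains u where "length u = k" "x = map (\<lambda>j. u ! (j - 1)) \<pi>" "set u = set x"
    "\<And>i. i < k \<Longrightarrow> u ! (\<pi> ! i - 1) = x ! i"
    "\<And>v. length v = k \<Longrightarrow> x = map (\<lambda>j. v ! (j - 1)) \<pi> \<Longrightarrow> v = u"
proof -
  note p = permutations_of_atLeastAtMostD[OF \<pi>]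
  have ex: "\<exists>i<k. \<pi> ! i = Suc j" if "j < k" for j
  proof -
    have "Suc j \<in> set \<pi>" using p that by auto
    then show ?thesis using p by (auto simp: in_set_conv_nth)
  qed
  \<comment> \<open>\<open>g\<close> is the inverse permutation on zero-based positions;
    \<open>u\<close> will be \<open>x\<close> composed with it.\<close>
  then obtain g where g: "\<And>j. j < k \<Longrightarrow> g j < k \<and> \<pi> ! g j = Suc j" by metis
  have rng: "\<pi> ! i \<in> {1..k}" if "i < k" for i using nth_mem[of i \<pi>] p that by auto
  have gp: "g (\<pi> ! i - 1) = i" if "i < k" for i
  proof -
    have "\<pi> ! i - 1 < k" using rng[OF that] by auto
    then have "g (\<pi> ! i - 1) < k" "\<pi> ! g (\<pi> ! i - 1) = \<pi> ! i" using g rng[OF that] by auto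
    then show ?thesis using p that by (simp add: nth_eq_iff_index_eq)
  qed
  define u where "u = map (\<lambda>j. x ! g j) [0..<k]"
  have len: "length u = k" by (simp add: u_def)
  have nth: "u ! (\<pi> ! i - 1) = x ! i" if "i < k" for i
  proof -
    have "\<pi> ! i - 1 < k" using rng[OF that] by auto
    then show ?thesis using gp[OF that] by (simp add: u_def)
  qed
  have eq: "x = map (\<lambda>j. u ! (j - 1)) \<pi>"
    by (rule nth_equalityI) (use x p nth in auto)
  have "set x \<subseteq> set u"
  proof
    fix z assume "z \<in> set x"
    then obtain i where i: "i < k" "z = u ! (\<pi> ! i - 1)" using x nth by (metis in_set_conv_nth)
    then show "z \<in> set u" using rng[OF i(1)] len by auto
  qed
  moreover have "set u \<subseteq> set x" using g x by (auto simp: u_def)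
  moreover have "v = u" if v: "length v = k" "x = map (\<lambda>j. v ! (j - 1)) \<pi>" for v
  proof (rule nth_equalityI)
    fix j assume "j < length v"
    then have j: "j < k" using v by simp
    have "x ! g j = v ! (\<pi> ! g j - 1)" using g[OF j] p by (subst v(2)) simp
    then show "v ! j = u ! j" using g[OF j] j by (simp add: u_def)
  qed (use v len in simp)
  ultimately show thesis using that len eq nth by blast
qed

text \<open>At most one pair \<open>(u, S)\<close> contributes: the two rows determine
  \<open>u\<close>, and the bottom row determines \<open>S\<close> as the letters left of
  \<open>1\<close>. The color over \<open>1\<close> is \<open>hd u\<close>, by domination the
  largest one, so the valley has to stand at the position \<open>p\<close> of the maximum of
  \<open>x\<close>, and \<open>card S = p\<close>.\<close>

lemma sum_lookup_Psi:
  assumes \<pi>: "\<pi> \<in> permutations_of_set {1..k}" and x: "length x = k"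
    and N: "finite N" "set x \<subseteq> N"
    and p: "p < k" "\<And>i. i < k \<Longrightarrow> i \<noteq> p \<Longrightarrow> x ! i < x ! p"
  shows "(\<Sum>u\<in>dominated_words N k X. Poly_Mapping.lookup (Psi q u) (x, \<pi>)) =
    (if (\<forall>z\<in>X. z < x ! p) \<and> decr (is_descent \<pi>) 0 (Suc p) \<and> incr (is_descent \<pi>) p k
     then (- q) ^ p else 0)"
proof -
  note perm = permutations_of_atLeastAtMostD[OF \<pi>]
  let ?U = "dominated_words N k X"
  define R where "R \<longleftrightarrow> (\<forall>z\<in>X. z < x ! p) \<and> decr (is_descent \<pi>) 0 (Suc p) \<and> incr (is_descent \<pi>) p k"
  define P where "P u S \<longleftrightarrow> \<pi> = valley S 1 [2..<Suc k] \<and> x = map (\<lambda>j. u ! (j - 1)) \<pi>" for u S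
  define S0 where "S0 = set (take p \<pi>)"
  obtain u0 where u0: "length u0 = k" "x = map (\<lambda>j. u0 ! (j - 1)) \<pi>" "set u0 = set x"
    "\<And>i. i < k \<Longrightarrow> u0 ! (\<pi> ! i - 1) = x ! i"
    "\<And>v. length v = k \<Longrightarrow> x = map (\<lambda>j. v ! (j - 1)) \<pi> \<Longrightarrow> v = u0"
    using ex_map_permutation_eq[OF \<pi> x] by metis
  have k: "0 < k" using p by simp
  have one: "\<pi> ! card S = 1" if "\<pi> = valley S 1 [2..<Suc k]" "S \<subseteq> {2..k}" for S
  proof -
    have "set (filter (\<lambda>x. x \<in> S) [2..<Suc k]) = S" using that(2) by auto
    then have "length (filter (\<lambda>x. x \<in> S) [2..<Suc k]) = card S"
      using distinct_card[of "filter (\<lambda>x. x \<in> S) [2..<Suc k]"] by simp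
    then show ?thesis unfolding that(1) valley_def by (simp add: nth_append)
  qed
  have cardS0: "card S0 = p"
    using perm p by (simp add: S0_def distinct_card)
  have PD: "R \<and> u = u0 \<and> S = S0" if P: "P u S" and u: "u \<in> ?U" and S: "S \<in> Pow {2..k}" for u S
  proof -
    have v: "\<pi> = valley S 1 [2..<Suc k]" and xu: "x = map (\<lambda>j. u ! (j - 1)) \<pi>"
      using P by (auto simp: P_def)
    have props: "card S < k" "S = set (take (card S) \<pi>)"
      "decr (is_descent \<pi>) 0 (Suc (card S))" "incr (is_descent \<pi>) (card S) k"
      using eq_valley_iff[OF \<pi> k, of S] v S by auto
    have lu: "length u = k" and dom: "initially_dominated u" and X: "\<forall>z\<in>X. z < hd u"
      using u by (auto simp: dominated_words_def)
    have hd: "hd u = u ! 0" using lu k by (cases u) auto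
    have "x ! card S = u ! 0"
      using one[OF v] S props(1) perm by (subst xu) auto
    moreover have "x ! p \<le> hd u"
    proof -
      have "\<pi> ! p - 1 < k" using nth_mem[of p \<pi>] perm p by auto
      then have "x ! p \<in> set u" using lu perm p by (subst xu) auto
      then show ?thesis using dom initially_dominated_le_hd by auto
    qed
    \<comment> \<open>\<open>x ! card S\<close> equals \<open>hd u\<close> and so is at least the
      maximum \<open>x ! p\<close>, which is attained only at \<open>p\<close>.\<close>
    ultimately have c: "card S = p" using p(2)[OF props(1)] hd by force
    have "u = u0" using u0(5) lu xu by simp
    moreover have "S = S0" using props c by (simp add: S0_def)
    moreover have R unfolding R_def using props c X hd \<open>x ! card S = u ! 0\<close> by simp
    ultimately show ?thesis by simp
  qed
  have PI: "u0 \<in> ?U \<and> S0 \<in> Pow {2..k} \<and> P u0 S0" if R: R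
  proof -
    have dr: "decr (is_descent \<pi>) 0 (Suc p)" "incr (is_descent \<pi>) p k" "\<forall>z\<in>X. z < x ! p"
      using R by (auto simp: R_def)
    have d: "sorted_wrt (>) (take (Suc p) \<pi>)" "sorted_wrt (<) (drop p \<pi>)"
      using dr decr_iff_sorted_wrt[of p \<pi>] incr_iff_sorted_wrt[of p \<pi>] p perm by auto
    have "take (Suc p) \<pi> = take p \<pi> @ [\<pi> ! p]" "drop p \<pi> = \<pi> ! p # drop (Suc p) \<pi>"
      using p perm by (simp_all add: take_Suc_conv_app_nth Cons_nth_drop_Suc)
    with d have less: "\<forall>y\<in>set (take p \<pi>) \<union> set (drop (Suc p) \<pi>). \<pi> ! p < y"
      by (auto simp: sorted_wrt_append)
    have "set \<pi> = set (take p \<pi>) \<union> {\<pi> ! p} \<union> set (drop (Suc p) \<pi>)"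
      using id_take_nth_drop[of p \<pi>] p perm by (metis Un_assoc list.simps(15) set_append insert_is_Un)
    then have un: "{1..k} = set (take p \<pi>) \<union> {\<pi> ! p} \<union> set (drop (Suc p) \<pi>)"
      using perm by simp
    have "1 \<in> {1..k}" "\<pi> ! p \<in> {1..k}" using k perm p nth_mem[of p \<pi>] by auto
    then have "1 \<in> set (take p \<pi>) \<union> {\<pi> ! p} \<union> set (drop (Suc p) \<pi>)" "1 \<le> \<pi> ! p"
      unfolding un[symmetric] by auto
    with less have one: "\<pi> ! p = 1" by force
    have S0: "S0 \<subseteq> {2..k}"
    proof
      fix y assume y: "y \<in> S0"
      then have "y \<in> {1..k}" unfolding un S0_def by blast
      moreover have "1 < y" using y less one by (auto simp: S0_def)
      ultimately show "y \<in> {2..k}" by simp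
    qed
    then have v: "\<pi> = valley S0 1 [2..<Suc k]"
      using eq_valley_iff[OF \<pi> k S0] cardS0 p dr by (simp add: S0_def)
    \<comment> \<open>The first color of \<open>u0\<close> stands over the bottom letter
      \<open>1\<close>, which is at \<open>p\<close>.\<close>
    have hd: "hd u0 = x ! p" using u0(4)[OF p(1)] one u0(1) k by (cases u0) auto
    have "initially_dominated u0"
      unfolding initially_dominated_def
    proof (intro conjI ballI)
      show "u0 \<noteq> []" using u0(1) k by auto
      fix z assume "z \<in> set (tl u0)"
      then obtain j where "j < length (tl u0)" "z = tl u0 ! j" by (metis in_set_conv_nth)
      then have j: "Suc j < k" "z = u0 ! Suc j" using u0(1) by (auto simp: nth_tl)
      have "Suc (Suc j) \<in> set \<pi>" using j perm by auto
      then obtain i where i: "i < k" "\<pi> ! i = Suc (Suc j)" using perm(1) by (metis in_set_conv_nth)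
      then have "i \<noteq> p" using one by auto
      moreover have "z = x ! i" using u0(4)[OF i(1)] i j by simp
      ultimately show "z < hd u0" using p(2)[OF i(1)] hd by simp
    qed
    then have "u0 \<in> ?U" using u0(1,3) N(2) dr(3) hd by (simp add: dominated_words_def)
    then show ?thesis using S0 v u0(2) unfolding P_def by blast
  qed
  have "(\<Sum>u\<in>?U. Poly_Mapping.lookup (Psi q u) (x, \<pi>)) =
    (\<Sum>u\<in>?U. \<Sum>S\<in>Pow {2..k}. if P u S then (- q) ^ card S else 0)"
  proof (rule sum.cong[OF refl])
    fix u assume "u \<in> ?U"
    then have "length u = k" "u \<noteq> []" by (auto simp: dominated_words_def initially_dominated_def)
    then show "Poly_Mapping.lookup (Psi q u) (x, \<pi>) =
        (\<Sum>S\<in>Pow {2..k}. if P u S then (- q) ^ card S else 0)"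
      by (simp add: lookup_Psi P_def)
  qed
  also have "\<dots> = (\<Sum>u\<in>?U. \<Sum>S\<in>Pow {2..k}. if S = S0 then (if u = u0 then (if R then (- q) ^ p else 0) else 0) else 0)"
  proof (intro sum.cong refl)
    fix u S assume "u \<in> ?U" "S \<in> Pow {2..k}"
    then have "P u S \<longleftrightarrow> R \<and> u = u0 \<and> S = S0" using PD PI by blast
    then show "(if P u S then (- q) ^ card S else 0) =
      (if S = S0 then (if u = u0 then (if R then (- q) ^ p else 0) else 0) else 0)"
      using cardS0 by auto
  qed
  also have "\<dots> = (if R then (- q) ^ p else 0)"
    using PI finite_dominated_words[OF N(1)] by (cases R) (simp_all add: sum.neutral)
  finally show ?thesis by (simp add: R_def)
qed

section \<open>Products of blocks\<close>

text \<open>Homogeneity with prescribed colors: the size of \<open>M\<close> tells where a biword is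
  cut in a product, and \<open>M\<close> itself which colors a factor uses.\<close>

definition supported_on :: "nat multiset \<Rightarrow> (biword \<Rightarrow>\<^sub>0 'k::comm_ring_1) \<Rightarrow> bool" where
  "supported_on M F \<longleftrightarrow> (\<forall>(x, \<pi>)\<in>Poly_Mapping.keys F.
     mset x = M \<and> \<pi> \<in> permutations_of_set {1..size M})"

lemma supported_onD:
  assumes "supported_on M F" "Poly_Mapping.lookup F (x, \<pi>) \<noteq> 0"
  shows "mset x = M" "\<pi> \<in> permutations_of_set {1..size M}" "length x = size M" "length \<pi> = size M"
proof -
  have "(x, \<pi>) \<in> Poly_Mapping.keys F" using assms(2) by (simp add: in_keys_iff)
  then show "mset x = M" "\<pi> \<in> permutations_of_set {1..size M}"
    using assms(1) by (auto simp: supported_on_def)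
  then show "length x = size M" "length \<pi> = size M"
    using permutations_of_atLeastAtMostD(1) by (metis size_mset)+
qed

lemma lookup_biw_mult_basis:
  "Poly_Mapping.lookup (\<Sum>\<gamma>\<in>convolution \<alpha> \<beta>. biw (u @ v) \<gamma>) (c, \<rho>) =
    (if c = u @ v \<and> \<rho> \<in> convolution \<alpha> \<beta> then 1 else 0)"
proof -
  have fin: "finite (convolution \<alpha> \<beta>)" by (simp add: convolution_def)
  have "Poly_Mapping.lookup (\<Sum>\<gamma>\<in>convolution \<alpha> \<beta>. biw (u @ v) \<gamma>) (c, \<rho>) =
    (\<Sum>\<gamma>\<in>convolution \<alpha> \<beta>. if \<gamma> = \<rho> then (if c = u @ v then 1 else 0) else 0)"
    unfolding lookup_sum by (intro sum.cong) (auto simp: lookup_biw)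
  also have "\<dots> = (if c = u @ v \<and> \<rho> \<in> convolution \<alpha> \<beta> then 1 else 0)"
    using fin by simp
  finally show ?thesis .
qed

lemma lookup_biw_mult:
  "Poly_Mapping.lookup (biw_mult F G) (c, \<rho>) =
    (\<Sum>(u, \<alpha>)\<in>Poly_Mapping.keys F. \<Sum>(v, \<beta>)\<in>Poly_Mapping.keys G.
      if c = u @ v \<and> \<rho> \<in> convolution \<alpha> \<beta>
      then Poly_Mapping.lookup F (u, \<alpha>) * Poly_Mapping.lookup G (v, \<beta>) else 0)"
  unfolding biw_mult_def bilinear_ext_def lookup_linear_ext
  by (auto simp: lookup_biw_mult_basis split_beta sum_distrib_left intro!: sum.cong)

lemma supported_on_biw_mult:
  assumes "supported_on M F" "supported_on N G"
  shows "supported_on (M + N) (biw_mult F G)"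
  unfolding supported_on_def
proof (clarify)
  fix c \<rho> assume "(c, \<rho>) \<in> Poly_Mapping.keys (biw_mult F G)"
  then have "Poly_Mapping.lookup (biw_mult F G) (c, \<rho>) \<noteq> 0" by (simp add: in_keys_iff)
  then obtain u \<alpha> v \<beta> where *: "(u, \<alpha>) \<in> Poly_Mapping.keys F" "(v, \<beta>) \<in> Poly_Mapping.keys G"
    "c = u @ v" "\<rho> \<in> convolution \<alpha> \<beta>"
    unfolding lookup_biw_mult by (force elim!: sum.not_neutral_contains_not_neutral split: if_splits)
  have "mset u = M" "mset v = N" "length \<alpha> = size M" "length \<beta> = size N"
    using * supported_onD[OF assms(1)] supported_onD[OF assms(2)] by (auto simp: in_keys_iff)
  then show "mset c = M + N \<and> \<rho> \<in> permutations_of_set {1..size (M + N)}"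
    using *(3,4) by (auto simp: convolution_def)
qed

text \<open>Only one pair of basis elements contributes: the two factors of \<open>c\<close> over
  the standardized factors of \<open>w\<close>. The bottom row is written as \<open>std w\<close>
  because the suffixes of a permutation, to which this is applied block after block, need not be
  permutations of an initial interval.\<close>

lemma lookup_biw_mult_std:
  assumes F: "supported_on M F" and G: "supported_on N G"
    and len: "length c = size M + size N" "length w = size M + size N" and w: "distinct w"
  shows "Poly_Mapping.lookup (biw_mult F G) (c, std w) =
    Poly_Mapping.lookup F (take (size M) c, std (take (size M) w)) *
    Poly_Mapping.lookup G (drop (size M) c, std (drop (size M) w))"
proof -
  let ?a = "size M"
  let ?x = "(take ?a c, std (take ?a w))" and ?y = "(drop ?a c, std (drop ?a w))"
  have cond: "c = u @ v \<and> std w \<in> convolution \<alpha> \<beta> \<longleftrightarrow> (u, \<alpha>) = ?x \<and> (v, \<beta>) = ?y"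
    if "(u, \<alpha>) \<in> Poly_Mapping.keys F" "(v, \<beta>) \<in> Poly_Mapping.keys G" for u \<alpha> v \<beta>
  proof -
    have l: "length u = ?a" "length \<alpha> = ?a" "length v = size N" "length \<beta> = size N"
      using that supported_onD[OF F] supported_onD[OF G] by (auto simp: in_keys_iff)
    have "c = u @ v \<longleftrightarrow> u = take ?a c \<and> v = drop ?a c"
      using l len(1) by (metis append_eq_conv_conj append_take_drop_id)
    moreover have "std w \<in> convolution \<alpha> \<beta> \<longleftrightarrow> \<alpha> = std (take ?a w) \<and> \<beta> = std (drop ?a w)"
      using l len(2) std_in_permutations[OF w] w
      by (auto simp: convolution_def std_take_std std_drop_std)
    ultimately show ?thesis by auto
  qed
  have "Poly_Mapping.lookup (biw_mult F G) (c, std w) =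
    (\<Sum>x\<in>Poly_Mapping.keys F. \<Sum>y\<in>Poly_Mapping.keys G. if y = ?y then
      (if x = ?x then Poly_Mapping.lookup F ?x * Poly_Mapping.lookup G ?y else 0) else 0)"
    unfolding lookup_biw_mult
  proof (intro sum.cong refl, clarify, intro sum.cong refl, clarify)
    fix u \<alpha> v \<beta> assume "(u, \<alpha>) \<in> Poly_Mapping.keys F" "(v, \<beta>) \<in> Poly_Mapping.keys G"
    from cond[OF this]
    show "(if c = u @ v \<and> std w \<in> convolution \<alpha> \<beta>
        then Poly_Mapping.lookup F (u, \<alpha>) * Poly_Mapping.lookup G (v, \<beta>) else 0) =
      (if (v, \<beta>) = ?y then (if (u, \<alpha>) = ?x
        then Poly_Mapping.lookup F ?x * Poly_Mapping.lookup G ?y else 0) else 0)"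
      by auto
  qed
  also have "\<dots> = Poly_Mapping.lookup F ?x * Poly_Mapping.lookup G ?y"
  proof -
    have "(\<Sum>y\<in>Poly_Mapping.keys G. if y = ?y then
      (if x = ?x then Poly_Mapping.lookup F ?x * Poly_Mapping.lookup G ?y else 0) else 0) =
      (if x = ?x then Poly_Mapping.lookup F ?x * Poly_Mapping.lookup G ?y else 0)" for x
      by (simp add: in_keys_iff)
    then show ?thesis by (simp add: in_keys_iff)
  qed
  finally show ?thesis .
qed

lemma mset_valley: "mset (valley S j js) = mset (j # js)"
  by (induction js) (auto simp: valley_def)

lemma supported_on_Psi:
  assumes "u \<noteq> []"
  shows "supported_on (mset u) (Psi q u)"
  unfolding supported_on_def
proof (clarify)
  fix x \<pi> assume "(x, \<pi>) \<in> Poly_Mapping.keys (Psi q u)"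
  then have "Poly_Mapping.lookup (Psi q u) (x, \<pi>) \<noteq> 0" by (simp add: in_keys_iff)
  then obtain S where S: "S \<subseteq> {2..length u}" "\<pi> = valley S 1 [2..<Suc (length u)]"
    "x = map (\<lambda>j. u ! (j - 1)) \<pi>"
    unfolding lookup_Psi[OF assms]
    by (auto elim!: sum.not_neutral_contains_not_neutral split: if_splits)
  have "mset \<pi> = mset (1 # [2..<Suc (length u)])"
    unfolding S(2) by (rule mset_valley)
  also have "1 # [2..<Suc (length u)] = [1..<Suc (length u)]"
    using assms by (subst upt_conv_Cons[of 1]) (auto simp: Suc_le_eq numeral_2_eq_2)
  finally have m: "mset \<pi> = mset [1..<Suc (length u)]" .
  have "\<pi> \<in> permutations_of_set {1..length u}"
    unfolding permutations_of_set_def mem_Collect_eq mset_eq_setD[OF m] mset_eq_imp_distinct_iff[OF m]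
      set_upt atLeastLessThanSuc_atLeastAtMost by simp
  moreover have "mset x = mset u"
  proof -
    have "mset x = mset (map (\<lambda>j. u ! (j - 1)) [1..<Suc (length u)])"
      unfolding S(3) mset_map m ..
    also have "map (\<lambda>j. u ! (j - 1)) [1..<Suc (length u)] = u"
      by (rule nth_equalityI) (simp_all del: upt_Suc)
    finally show ?thesis .
  qed
  ultimately show "mset x = mset u \<and> \<pi> \<in> permutations_of_set {1..size (mset u)}" by simp
qed

lemma supported_on_biw_empty: "supported_on {#} (biw [] [])"
  by (auto simp: supported_on_def biw_def split: if_splits)

definition Psi_product :: "'k::comm_ring_1 \<Rightarrow> nat list list \<Rightarrow> (biword \<Rightarrow>\<^sub>0 'k)" where
  "Psi_product q us = foldr biw_mult (map (Psi q) us) (biw [] [])"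

lemma Psi_product_simps [simp]:
  "Psi_product q [] = biw [] []"
  "Psi_product q (u # us) = biw_mult (Psi q u) (Psi_product q us)"
  by (simp_all add: Psi_product_def)

lemma supported_on_Psi_product:
  "[] \<notin> set us \<Longrightarrow> supported_on (mset (concat us)) (Psi_product q us)"
  by (induction us) (auto simp: supported_on_biw_empty intro!: supported_on_biw_mult supported_on_Psi)

text \<open>
  \<open>X\<close> accumulates the letters used so far. Asking every first letter to exceed all of them makes the
  condition local to each word; for distinct letters it means that the first letters increase.
\<close>

fun dominated_sequences :: "nat set \<Rightarrow> nat list \<Rightarrow> nat set \<Rightarrow> nat list list set" where
  "dominated_sequences N [] X = {[]}"
| "dominated_sequences N (k # K) X =
    (\<Union>u\<in>dominated_words N k X. (#) u ` dominated_sequences N K (X \<union> set u))"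

lemma Cons_in_dominated_sequences_iff:
  "u # us \<in> dominated_sequences N (k # K) X \<longleftrightarrow>
    u \<in> dominated_words N k X \<and> us \<in> dominated_sequences N K (X \<union> set u)"
  by auto

lemma finite_dominated_sequences: "finite N \<Longrightarrow> finite (dominated_sequences N K X)"
  by (induction K arbitrary: X) (auto simp: finite_dominated_words)

lemma sum_dominated_sequences_Cons:
  assumes "finite N"
  shows "(\<Sum>us\<in>dominated_sequences N (k # K) X. h us) =
    (\<Sum>u\<in>dominated_words N k X. \<Sum>us\<in>dominated_sequences N K (X \<union> set u). h (u # us))"
proof -
  have "(\<Sum>us\<in>dominated_sequences N (k # K) X. h us) =
    (\<Sum>u\<in>dominated_words N k X. \<Sum>us\<in>(#) u ` dominated_sequences N K (X \<union> set u). h us)"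
    unfolding dominated_sequences.simps
    by (rule sum.UNION_disjoint)
      (auto simp: finite_dominated_words finite_dominated_sequences assms)
  then show ?thesis by (simp add: sum.reindex)
qed

lemma dominated_sequences_sorted_iff:
  assumes "distinct (concat us)"
  shows "us \<in> dominated_sequences N K X \<longleftrightarrow>
    map length us = K \<and> set (concat us) \<subseteq> N \<and> (\<forall>u\<in>set us. initially_dominated u) \<and>
    sorted (map hd us) \<and> (\<forall>u\<in>set us. \<forall>z\<in>X. z < hd u)"
  using assms
proof (induction us arbitrary: K X)
  case Nil
  then show ?case by (cases K) auto
next
  case (Cons u us)
  show ?case
  proof (cases K)
    case K: (Cons k K')
    have IH: "us \<in> dominated_sequences N K' (X \<union> set u) \<longleftrightarrow>
      map length us = K' \<and> set (concat us) \<subseteq> N \<and> (\<forall>u\<in>set us. initially_dominated u) \<and>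
      sorted (map hd us) \<and> (\<forall>v\<in>set us. \<forall>z\<in>X \<union> set u. z < hd v)"
      using Cons.prems by (intro Cons.IH) auto
    \<comment> \<open>The first letter of a dominated word is its maximum, so comparing first
      letters suffices; distinctness turns \<open>\<le>\<close> into \<open><\<close>.\<close>
    have key: "(\<forall>v\<in>set us. \<forall>z\<in>set u. z < hd v) \<longleftrightarrow> (\<forall>v\<in>set us. hd u \<le> hd v)"
      if dom: "initially_dominated u" "\<forall>v\<in>set us. initially_dominated v"
    proof (intro iffI ballI)
      fix v assume *: "\<forall>v\<in>set us. \<forall>z\<in>set u. z < hd v" and v: "v \<in> set us"
      have "hd u \<in> set u" using dom(1) by (simp add: initially_dominated_def)
      then show "hd u \<le> hd v" using * v by fastforce
    next
      fix v z assume *: "\<forall>v\<in>set us. hd u \<le> hd v" and v: "v \<in> set us" and z: "z \<in> set u"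
      have "hd v \<in> set v" using dom(2) v by (simp add: initially_dominated_def)
      then have "hd v \<notin> set u" using Cons.prems v by auto
      then have "z \<noteq> hd v" using z by auto
      moreover have "z \<le> hd u" using initially_dominated_le_hd[OF dom(1) z] .
      moreover have "hd u \<le> hd v" using * v by blast
      ultimately show "z < hd v" by linarith
    qed
    show ?thesis
      unfolding K Cons_in_dominated_sequences_iff IH
      using key by (auto simp: dominated_words_def)
  qed simp
qed

section \<open>Blocks of a fixed biword\<close>

lemma decr_cong: "(\<And>i. s \<le> i \<Longrightarrow> Suc i < e \<Longrightarrow> d i = d' i) \<Longrightarrow> decr d s e = decr d' s e"
  by (auto simp: decr_def)

lemma incr_cong: "(\<And>i. s \<le> i \<Longrightarrow> Suc i < e \<Longrightarrow> d i = d' i) \<Longrightarrow> incr d s e = incr d' s e"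
  by (auto simp: incr_def)

lemma decr_shift: "decr (\<lambda>i. d (s + i)) a b \<longleftrightarrow> decr d (s + a) (s + b)"
proof -
  have "(\<forall>i. a \<le> i \<and> Suc i < b \<longrightarrow> d (s + i)) \<longleftrightarrow> (\<forall>i. s + a \<le> i \<and> Suc i < s + b \<longrightarrow> d i)"
    (is "?l \<longleftrightarrow> ?r")
  proof
    assume l: ?l
    show ?r
    proof (intro allI impI)
      fix i assume i: "s + a \<le> i \<and> Suc i < s + b"
      then have "a \<le> i - s \<and> Suc (i - s) < b" by linarith
      with l have "d (s + (i - s))" by blast
      with i show "d i" by simp
    qed
  qed auto
  then show ?thesis by (simp add: decr_def)
qed

lemma incr_shift: "incr (\<lambda>i. d (s + i)) a b \<longleftrightarrow> incr d (s + a) (s + b)"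
  using decr_shift[of "\<lambda>i. \<not> d i"] by (simp add: incr_def decr_def)

lemma is_descent_std:
  "distinct w \<Longrightarrow> Suc i < length w \<Longrightarrow> is_descent (std w) i = is_descent w i"
  by (simp add: is_descent_def std_nth_less_iff)

text \<open>Only the maximum of the block, at offset \<open>p\<close>, can be its last record: later
  letters are smaller, and a record anywhere in the block puts the maximum above the prefix. So
  \<open>hd u\<close> exceeds the prefix exactly if the block has a record, and then
  \<open>p\<close> is the value of \<open>last_true\<close>.\<close>

lemma sum_lookup_Psi_block:
  assumes c: "distinct c" "set c \<subseteq> N" "finite N" and \<tau>: "distinct \<tau>" "length \<tau> = length c"
    and k: "0 < k" "s + k \<le> length c"
  shows "(\<Sum>u\<in>dominated_words N k (set (take s c)).
      Poly_Mapping.lookup (Psi q u) (take k (drop s c), std (take k (drop s \<tau>)))) =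
    valley_weight q (is_record c) (is_descent \<tau>) s (s + k)"
proof -
  define x y where "x = take k (drop s c)" and "y = take k (drop s \<tau>)"
  have x: "length x = k" "distinct x" "set x \<subseteq> N" and xi: "\<And>i. i < k \<Longrightarrow> x ! i = c ! (s + i)"
    using c k by (auto simp: x_def dest: in_set_takeD in_set_dropD)
  have y: "length y = k" "distinct y" and yi: "\<And>i. i < k \<Longrightarrow> y ! i = \<tau> ! (s + i)"
    using \<tau> k by (auto simp: y_def)
  have "Max (set x) \<in> set x" using x k by (intro Max_in) auto
  then obtain p where p: "p < k" "x ! p = Max (set x)" using x by (metis in_set_conv_nth)
  have pmax: "x ! i < x ! p" if "i < k" "i \<noteq> p" for i
  proof -
    have "x ! i \<le> x ! p" unfolding p(2) using that x by (intro Max_ge) auto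
    moreover have "x ! i \<noteq> x ! p" using that p(1) x by (simp add: nth_eq_iff_index_eq)
    ultimately show ?thesis by simp
  qed
  let ?r = "is_record c"
  have X: "(\<forall>z\<in>set (take s c). z < m) \<longleftrightarrow> (\<forall>i<s. c ! i < m)" for m
    using k by (auto simp: all_set_conv_all_nth)
  have nrec: "\<not> ?r (s + i)" if "p < i" "i < k" for i
    using pmax[of i] that xi p unfolding is_record_def by (auto intro!: exI[of _ "s + p"])
  have recp: "?r (s + p) \<longleftrightarrow> (\<forall>i<s. c ! i < x ! p)"
  proof
    assume *: "\<forall>i<s. c ! i < x ! p"
    show "?r (s + p)"
      unfolding is_record_def
    proof (intro allI impI)
      fix i assume i: "i < s + p"
      show "c ! i < c ! (s + p)"
      proof (cases "i < s")
        case False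
        then show ?thesis using pmax[of "i - s"] xi[of "i - s"] xi[of p] i p by auto
      qed (use * xi p in auto)
    qed
  qed (use xi p in \<open>auto simp: is_record_def\<close>)
  have ex: "(\<exists>i\<in>{s..<s + k}. ?r i) \<longleftrightarrow> ?r (s + p)"
  proof
    assume "\<exists>i\<in>{s..<s + k}. ?r i"
    then obtain i where i: "i < k" "?r (s + i)"
      by (auto simp: Bex_def) (metis le_add_diff_inverse nat_add_left_cancel_less)
    have "x ! i \<le> x ! p" using pmax[of i] i by (cases "i = p") auto
    moreover have "\<forall>j<s. c ! j < x ! i" using i xi by (auto simp: is_record_def)
    ultimately show "?r (s + p)" unfolding recp by fastforce
  qed (use p in auto)
  have lt: "last_true ?r s k = p" if "?r (s + p)"
  proof (rule last_true_eqI)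
    show "\<not> ?r i" if "s + p < i" "i < s + k" for i
      using nrec[of "i - s"] that by auto
  qed (use that p in auto)
  have desc: "is_descent (std y) i = is_descent \<tau> (s + i)" if "Suc i < k" for i
    using is_descent_std[of y i] that y yi by (simp add: is_descent_def)
  have "decr (is_descent (std y)) 0 (Suc p) = decr (\<lambda>i. is_descent \<tau> (s + i)) 0 (Suc p)"
    by (rule decr_cong) (use desc p in auto)
  then have d: "decr (is_descent (std y)) 0 (Suc p) = decr (is_descent \<tau>) s (Suc (s + p))"
    by (simp add: decr_shift)
  have "incr (is_descent (std y)) p k = incr (\<lambda>i. is_descent \<tau> (s + i)) p k"
    by (rule incr_cong) (use desc p in auto)
  then have e: "incr (is_descent (std y)) p k = incr (is_descent \<tau>) (s + p) (s + k)"
    by (simp add: incr_shift)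
  have "std y \<in> permutations_of_set {1..k}" using std_in_permutations[OF y(2)] y by simp
  from sum_lookup_Psi[OF this x(1) c(3) x(3) p(1), where X = "set (take s c)" and q = q] pmax
  have "(\<Sum>u\<in>dominated_words N k (set (take s c)). Poly_Mapping.lookup (Psi q u) (x, std y)) =
    (if (\<forall>z\<in>set (take s c). z < x ! p) \<and> decr (is_descent (std y)) 0 (Suc p) \<and>
       incr (is_descent (std y)) p k then (- q) ^ p else 0)"
    by blast
  then have "(\<Sum>u\<in>dominated_words N k (set (take s c)). Poly_Mapping.lookup (Psi q u) (x, std y)) =
    (if ?r (s + p) \<and> decr (is_descent \<tau>) s (Suc (s + p)) \<and> incr (is_descent \<tau>) (s + p) (s + k)
     then (- q) ^ p else 0)"
    unfolding X d e recp[symmetric] .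
  also have "\<dots> = valley_weight q ?r (is_descent \<tau>) s (s + k)"
    using ex lt by (auto simp: valley_weight_def Let_def)
  finally show ?thesis by (simp add: x_def y_def)
qed

lemma dominated_sequences_nonempty:
  "us \<in> dominated_sequences N K X \<Longrightarrow> [] \<notin> set us \<and> map length us = K"
proof (induction K arbitrary: us X)
  case (Cons k K)
  then obtain u vs where "us = u # vs" "u \<in> dominated_words N k X"
    "vs \<in> dominated_sequences N K (X \<union> set u)" by auto
  with Cons.IH[of vs "X \<union> set u"] show ?case
    by (auto simp: dominated_words_def initially_dominated_def)
qed simp

text \<open>The admissible \<open>us\<close> depend on the letters of \<open>u\<close>, so the sum
  does not factor by itself. A nonzero coefficient, however, forces \<open>u\<close> to use the
  letters of its block of \<open>c\<close>, and then the letters used so far are those of a prefix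
  of \<open>c\<close>, the same for all such \<open>u\<close>.\<close>

lemma sum_lookup_Psi_product:
  assumes c: "distinct c" "set c \<subseteq> N" "finite N" and \<tau>: "distinct \<tau>" "length \<tau> = length c"
    and K: "K \<in> compositions (length c - s)" and s: "s \<le> length c"
  shows "(\<Sum>us\<in>dominated_sequences N K (set (take s c)).
      Poly_Mapping.lookup (Psi_product q us) (drop s c, std (drop s \<tau>))) =
    path_prod (valley_weight q (is_record c) (is_descent \<tau>)) s K"
  using K s
proof (induction K arbitrary: s)
  case Nil
  then have "s = length c" by (auto simp: compositions_def)
  then show ?case using \<tau> by (simp add: lookup_biw std_def)
next
  case (Cons k K)
  then have k: "0 < k" "s + k \<le> length c" "K \<in> compositions (length c - (s + k))"
    by (auto simp: Cons_in_compositions_iff)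
  let ?c = "drop s c" and ?t = "drop s \<tau>" and ?X = "set (take s c)"
  let ?P = "\<lambda>us. Poly_Mapping.lookup (Psi_product q us) (drop (s + k) c, std (drop (s + k) \<tau>))"
  let ?g = "valley_weight q (is_record c) (is_descent \<tau>)"
  have IH: "(\<Sum>us\<in>dominated_sequences N K (set (take (s + k) c)). ?P us) = path_prod ?g (s + k) K"
    by (rule Cons.IH) (use k in auto)
  have "(\<Sum>us\<in>dominated_sequences N (k # K) ?X. Poly_Mapping.lookup (Psi_product q us) (?c, std ?t)) =
    (\<Sum>u\<in>dominated_words N k ?X. \<Sum>us\<in>dominated_sequences N K (?X \<union> set u).
      Poly_Mapping.lookup (Psi q u) (take k ?c, std (take k ?t)) * ?P us)"
    unfolding sum_dominated_sequences_Cons[OF c(3)]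
  proof (intro sum.cong refl)
    fix u us assume u: "u \<in> dominated_words N k ?X" and us: "us \<in> dominated_sequences N K (?X \<union> set u)"
    have u': "u \<noteq> []" "length u = k" using u by (auto simp: dominated_words_def initially_dominated_def)
    have us': "[] \<notin> set us" "map length us = K" using dominated_sequences_nonempty[OF us] by auto
    then have "length (concat us) = length c - (s + k)"
      using k by (auto simp: length_concat compositions_def)
    then have "Poly_Mapping.lookup (biw_mult (Psi q u) (Psi_product q us)) (?c, std ?t) =
      Poly_Mapping.lookup (Psi q u) (take (size (mset u)) ?c, std (take (size (mset u)) ?t)) *
      Poly_Mapping.lookup (Psi_product q us) (drop (size (mset u)) ?c, std (drop (size (mset u)) ?t))"
      using u' k \<tau> us'
      by (intro lookup_biw_mult_std[OF supported_on_Psi supported_on_Psi_product]) auto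
    then show "Poly_Mapping.lookup (Psi_product q (u # us)) (?c, std ?t) =
        Poly_Mapping.lookup (Psi q u) (take k ?c, std (take k ?t)) * ?P us"
      using u' by (simp add: add.commute)
  qed
  also have "\<dots> = (\<Sum>u\<in>dominated_words N k ?X.
      Poly_Mapping.lookup (Psi q u) (take k ?c, std (take k ?t)) * path_prod ?g (s + k) K)"
  proof (rule sum.cong[OF refl])
    fix u assume u: "u \<in> dominated_words N k ?X"
    let ?L = "Poly_Mapping.lookup (Psi q u) (take k ?c, std (take k ?t))"
    show "(\<Sum>us\<in>dominated_sequences N K (?X \<union> set u). ?L * ?P us) = ?L * path_prod ?g (s + k) K"
    proof (cases "?L = 0")
      case False
      have "u \<noteq> []" using u by (auto simp: dominated_words_def initially_dominated_def)
      then have "mset (take k ?c) = mset u" using supported_onD(1)[OF supported_on_Psi False] by simp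
      then have "set u = set (take k ?c)" by (metis mset_eq_setD)
      then have "?X \<union> set u = set (take (s + k) c)" by (simp add: take_add)
      then show ?thesis using IH by (simp add: sum_distrib_left[symmetric])
    qed simp
  qed
  also have "\<dots> = ?g s (s + k) * path_prod ?g (s + k) K"
    unfolding sum_distrib_right[symmetric] sum_lookup_Psi_block[OF c \<tau> k(1,2)] ..
  finally show ?case by simp
qed

section \<open>Coefficients of the left-hand side\<close>

lemma Psi_perm_eq: "Psi_perm q \<sigma> = Psi_product q (dominated_factorization \<sigma>)"
  by (simp add: Psi_perm_def Psi_product_def)

lemma dominated_factorization_props:
  "concat (dominated_factorization \<sigma>) = \<sigma>" "[] \<notin> set (dominated_factorization \<sigma>)"
  using is_dominated_factorization_the[of "dominated_factorization \<sigma>" \<sigma>]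
  by (auto simp: is_dominated_factorization_def initially_dominated_def)

lemma supported_on_Psi_perm: "supported_on (mset \<sigma>) (Psi_perm q \<sigma>)"
  unfolding Psi_perm_eq using supported_on_Psi_product dominated_factorization_props by metis

lemma saillance_comp_in_compositions: "distinct c \<Longrightarrow> saillance_comp c \<in> compositions (length c)"
  by (simp add: saillance_comp_run_lengths run_lengths_in_compositions)

text \<open>A permutation and its factorization determine each other, so a sum over permutations
  with given saillance composition becomes a sum over sequences that are built block by
  block.\<close>

lemma dominated_factorization_image:
  "dominated_factorization ` {\<sigma> \<in> permutations_of_set {1..n}. saillance_comp \<sigma> = K} =
    {us \<in> dominated_sequences {1..n} K {}. concat us \<in> permutations_of_set {1..n}}"
proof (intro equalityI subsetI)
  fix us assume "us \<in> dominated_factorization ` {\<sigma> \<in> permutations_of_set {1..n}. saillance_comp \<sigma> = K}"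
  then obtain \<sigma> where \<sigma>: "\<sigma> \<in> permutations_of_set {1..n}" "saillance_comp \<sigma> = K"
    "us = dominated_factorization \<sigma>" by auto
  then have us: "is_dominated_factorization us \<sigma>" by (simp add: is_dominated_factorization_the)
  then have "distinct (concat us)" using \<sigma> by (auto simp: is_dominated_factorization_def permutations_of_set_def)
  then show "us \<in> {us \<in> dominated_sequences {1..n} K {}. concat us \<in> permutations_of_set {1..n}}"
    using us \<sigma> permutations_of_atLeastAtMostD[OF \<sigma>(1)]
    unfolding mem_Collect_eq by (subst dominated_sequences_sorted_iff)
      (auto simp: is_dominated_factorization_def saillance_comp_def)
next
  fix us assume us: "us \<in> {us \<in> dominated_sequences {1..n} K {}. concat us \<in> permutations_of_set {1..n}}"
  then have "distinct (concat us)" by (auto simp: permutations_of_set_def)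
  with us have *: "map length us = K" "\<forall>u\<in>set us. initially_dominated u" "sorted (map hd us)"
    using dominated_sequences_sorted_iff[of us "{1..n}" K "{}"] by auto
  then have "is_dominated_factorization us (concat us)" by (simp add: is_dominated_factorization_def)
  then have eq: "us = dominated_factorization (concat us)" by (simp only: is_dominated_factorization_the)
  then have "saillance_comp (concat us) = K" using * by (simp add: saillance_comp_def)
  with us eq show "us \<in> dominated_factorization ` {\<sigma> \<in> permutations_of_set {1..n}. saillance_comp \<sigma> = K}"
    by blast
qed

lemma lookup_sum_Psi_perm:
  assumes c: "c \<in> permutations_of_set {1..n}" and \<tau>: "\<tau> \<in> permutations_of_set {1..n}"
  shows "(\<Sum>\<sigma>\<in>permutations_of_set {1..n}. Poly_Mapping.lookup (Psi_perm q \<sigma>) (c, \<tau>)) =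
    path_sum (valley_weight q (is_record c) (is_descent \<tau>)) n 0"
proof -
  note cp = permutations_of_atLeastAtMostD[OF c] and tp = permutations_of_atLeastAtMostD[OF \<tau>]
  let ?h = "\<lambda>\<sigma>. Poly_Mapping.lookup (Psi_perm q \<sigma>) (c, \<tau>)"
  let ?P = "permutations_of_set {1..n}"
  have "(\<Sum>\<sigma>\<in>?P. ?h \<sigma>) = (\<Sum>K\<in>compositions n. \<Sum>\<sigma>\<in>{\<sigma> \<in> ?P. saillance_comp \<sigma> = K}. ?h \<sigma>)"
  proof (rule sum.group[symmetric])
    show "saillance_comp ` ?P \<subseteq> compositions n"
      using saillance_comp_in_compositions permutations_of_atLeastAtMostD(1,2) by fastforce
  qed (simp_all add: finite_compositions)
  also have "\<dots> = (\<Sum>K\<in>compositions n. path_prod (valley_weight q (is_record c) (is_descent \<tau>)) 0 K)"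
  proof (rule sum.cong[OF refl])
    fix K assume K: "K \<in> compositions n"
    let ?D = "dominated_sequences {1..n} K {}"
    let ?H = "\<lambda>us. Poly_Mapping.lookup (Psi_product q us) (c, \<tau>)"
    have "inj_on dominated_factorization A" for A
      by (metis dominated_factorization_props(1) inj_onI)
    then have "(\<Sum>\<sigma>\<in>{\<sigma> \<in> ?P. saillance_comp \<sigma> = K}. ?h \<sigma>) =
        (\<Sum>us\<in>{us \<in> ?D. concat us \<in> ?P}. ?H us)"
      unfolding dominated_factorization_image[symmetric] Psi_perm_eq
      by (subst sum.reindex) auto
    \<comment> \<open>Sequences whose concatenation is no permutation are added so that the sum can
      be taken block by block; their products have another multiset of colors than \<open>c\<close>,
      hence coefficient \<open>0\<close>.\<close>
    also have "\<dots> = (\<Sum>us\<in>?D. ?H us)"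
    proof (rule sum.mono_neutral_left)
      show "\<forall>us\<in>?D - {us \<in> ?D. concat us \<in> ?P}. ?H us = 0"
      proof
        fix us assume us: "us \<in> ?D - {us \<in> ?D. concat us \<in> ?P}"
        show "?H us = 0"
        proof (rule ccontr)
          assume "?H us \<noteq> 0"
          moreover have "[] \<notin> set us" using us dominated_sequences_nonempty by auto
          ultimately have "mset c = mset (concat us)"
            using supported_onD(1)[OF supported_on_Psi_product] by blast
          then have "set (concat us) = set c" "distinct (concat us)"
            using cp mset_eq_setD[of c "concat us"] mset_eq_imp_distinct_iff[of c "concat us"] by auto
          then show False using us cp by (auto simp: permutations_of_set_def)
        qed
      qed
    qed (auto simp: finite_dominated_sequences)
    \<comment> \<open>\<open>\<tau>\<close> is its own standardization, so the statement on suffixes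
      applies at \<open>s = 0\<close>.\<close>
    also have "\<dots> = path_prod (valley_weight q (is_record c) (is_descent \<tau>)) 0 K"
      using sum_lookup_Psi_product[of c "{1..n}" \<tau> K 0 q] cp tp K std_permutation[OF \<tau>] by simp
    finally show "(\<Sum>\<sigma>\<in>{\<sigma> \<in> ?P. saillance_comp \<sigma> = K}. ?h \<sigma>) =
      path_prod (valley_weight q (is_record c) (is_descent \<tau>)) 0 K" .
  qed
  finally show ?thesis by (simp add: path_sum_def)
qed

section \<open>Coefficients of the right-hand side\<close>

lemma lookup_ribbon:
  assumes "I \<in> compositions n"
  shows "Poly_Mapping.lookup (ribbon I J) (c, \<tau>) =
    (if c \<in> permutations_of_set {1..n} \<and> \<tau> \<in> permutations_of_set {1..n} \<and>
        descent_comp \<tau> = I \<and> saillance_comp c = J then 1 else 0)"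
proof -
  have n: "sum_list I = n" using assms by (simp add: compositions_def)
  let ?A = "{\<tau> \<in> permutations_of_set {1..n}. descent_comp \<tau> = I}"
  let ?B = "{\<sigma> \<in> permutations_of_set {1..n}. saillance_comp \<sigma> = J}"
  have "Poly_Mapping.lookup (ribbon I J) (c, \<tau>) =
    (\<Sum>\<tau>'\<in>?A. \<Sum>\<sigma>\<in>?B. if \<sigma> = c then (if \<tau>' = \<tau> then 1 else 0) else 0)"
    unfolding ribbon_def n lookup_sum by (intro sum.cong refl) (simp add: lookup_biw)
  also have "\<dots> = (\<Sum>\<tau>'\<in>?A. if \<tau>' = \<tau> then (if c \<in> ?B then 1 else 0) else 0)"
    by (intro sum.cong refl) (simp add: sum.delta)
  also have "\<dots> = (if c \<in> permutations_of_set {1..n} \<and> \<tau> \<in> permutations_of_set {1..n} \<and>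
        descent_comp \<tau> = I \<and> saillance_comp c = J then 1 else 0)"
    by (simp add: sum.delta)
  finally show ?thesis .
qed

text \<open>A permutation has only one descent composition, so at most one of the ribbons
  contributes.\<close>

lemma lookup_Lam:
  assumes "I \<in> compositions n"
  shows "Poly_Mapping.lookup (Lam I J) (c, \<tau>) =
    (if c \<in> permutations_of_set {1..n} \<and> \<tau> \<in> permutations_of_set {1..n} \<and>
        {1..<n} - Des I \<subseteq> Des (descent_comp \<tau>) \<and> saillance_comp c = J then 1 else 0)"
proof -
  have n: "sum_list I = n" using assms by (simp add: compositions_def)
  let ?A = "{I' \<in> compositions n. {1..<n} - Des I \<subseteq> Des I'}"
  let ?p = "c \<in> permutations_of_set {1..n} \<and> \<tau> \<in> permutations_of_set {1..n} \<and> saillance_comp c = J"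
  have "Poly_Mapping.lookup (Lam I J) (c, \<tau>) = (\<Sum>I'\<in>?A. if I' = descent_comp \<tau> then (if ?p then 1 else 0) else 0)"
    unfolding Lam_def n lookup_sum by (intro sum.cong refl) (auto simp: lookup_ribbon)
  also have "\<dots> = (if descent_comp \<tau> \<in> ?A \<and> ?p then 1 else 0)"
    using finite_compositions[of n] by (auto simp: sum.delta)
  also have "\<dots> = (if c \<in> permutations_of_set {1..n} \<and> \<tau> \<in> permutations_of_set {1..n} \<and>
        {1..<n} - Des I \<subseteq> Des (descent_comp \<tau>) \<and> saillance_comp c = J then 1 else 0)"
    using descent_comp_in_compositions[of \<tau>] permutations_of_atLeastAtMostD(1)[of \<tau> n] by auto
  finally show ?thesis .
qed

text \<open>Only \<open>J = saillance_comp c\<close> contributes. It is the list of run lengths cut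
  at the records of \<open>c\<close>, so \<open>D_stat I J\<close> is a sum over the blocks of
  \<open>I\<close> and every term factors into block weights.\<close>

lemma lookup_sum_Lam:
  assumes "n \<ge> 1" and c: "c \<in> permutations_of_set {1..n}" and \<tau>: "\<tau> \<in> permutations_of_set {1..n}"
  shows "(\<Sum>I\<in>compositions n. \<Sum>J\<in>compositions n.
      (-1) ^ (n - length I) * q ^ D_stat I J * Poly_Mapping.lookup (Lam I J) (c, \<tau>)) =
    path_sum (dec_weight q (is_record c) (is_descent \<tau>)) n 0"
  unfolding path_sum_def diff_zero
proof (rule sum.cong[OF refl])
  note cp = permutations_of_atLeastAtMostD[OF c] and tp = permutations_of_atLeastAtMostD[OF \<tau>]
  fix I assume I: "I \<in> compositions n"
  let ?S = "saillance_comp c" and ?b = "{1..<n} - Des I \<subseteq> Des (descent_comp \<tau>)"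
  have S: "?S = run_lengths (is_record c) 0 n" "?S \<in> compositions n"
    using saillance_comp_run_lengths[of c] saillance_comp_in_compositions[of c] cp by auto
  have "(\<Sum>J\<in>compositions n.
      (-1) ^ (n - length I) * q ^ D_stat I J * Poly_Mapping.lookup (Lam I J) (c, \<tau>)) =
    (\<Sum>J\<in>compositions n. if J = ?S then (if ?b then (-1) ^ (n - length I) * q ^ D_stat I ?S else 0) else 0)"
    by (intro sum.cong refl) (simp add: lookup_Lam[OF I] c \<tau> del: One_nat_def)
  also have "\<dots> = (if ?b then (-1) ^ (n - length I) * q ^ last_true_sum (is_record c) 0 I else 0)"
    using S by (simp add: finite_compositions D_stat_run_lengths[OF I assms(1)])
  \<comment> \<open>\<open>Des\<close> counts positions from one, \<open>is_descent\<close> from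
    zero; \<open>0 + p - 1\<close> is the form taken by \<open>path_prod_dec_weight\<close> at
    \<open>s = 0\<close>.\<close>
  also have "?b \<longleftrightarrow> (\<forall>p\<in>{1..<n} - Des I. is_descent \<tau> (0 + p - 1))"
    unfolding Des_descent_comp[OF tp(2)] using tp(1) by (fastforce simp: is_descent_def)
  finally show "(\<Sum>J\<in>compositions n.
      (-1) ^ (n - length I) * q ^ D_stat I J * Poly_Mapping.lookup (Lam I J) (c, \<tau>)) =
    path_prod (dec_weight q (is_record c) (is_descent \<tau>)) 0 I"
    unfolding path_prod_dec_weight[OF I] .
qed

theorem theorem3p3:
  fixes q :: "'k::comm_ring_1" and n :: nat
  assumes "n \<ge> 1"
  shows "(\<Sum>\<sigma>\<in>permutations_of_set {1..n}. Psi_perm q \<sigma>) =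
    (\<Sum>I\<in>compositions n. \<Sum>J\<in>compositions n.
       smult ((-1) ^ (n - length I) * q ^ D_stat I J) (Lam I J))"
proof (rule poly_mapping_eqI)
  fix b :: biword
  obtain c \<tau> where b: "b = (c, \<tau>)" by (cases b)
  let ?P = "permutations_of_set {1..n}"
  show "Poly_Mapping.lookup (\<Sum>\<sigma>\<in>?P. Psi_perm q \<sigma>) b =
    Poly_Mapping.lookup (\<Sum>I\<in>compositions n. \<Sum>J\<in>compositions n.
       smult ((-1) ^ (n - length I) * q ^ D_stat I J) (Lam I J)) b"
  proof (cases "c \<in> ?P \<and> \<tau> \<in> ?P")
    case True
    \<comment> \<open>No letter precedes the first position; from a record on, the two path sums
      agree.\<close>
    have "is_record c 0" by (simp add: is_record_def)
    then show ?thesis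
      unfolding b lookup_sum lookup_smult
      using True assms
      by (simp add: lookup_sum_Lam lookup_sum_Psi_perm path_sum_dec_eq_valley del: One_nat_def)
  next
    case False
    \<comment> \<open>A nonzero coefficient would make both rows permutations: the colors are those
      of \<open>\<sigma>\<close>, and the bottom row is one by the support property.\<close>
    have "Poly_Mapping.lookup (Psi_perm q \<sigma>) (c, \<tau>) = 0" if \<sigma>: "\<sigma> \<in> ?P" for \<sigma>
    proof (rule ccontr)
      note sp = permutations_of_atLeastAtMostD[OF \<sigma>]
      assume "Poly_Mapping.lookup (Psi_perm q \<sigma>) (c, \<tau>) \<noteq> 0"
      note * = supported_onD[OF supported_on_Psi_perm this]
      then have "c \<in> ?P"
        using sp mset_eq_setD[OF *(1)] mset_eq_imp_distinct_iff[OF *(1)]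
        by (simp add: permutations_of_set_def)
      then show False using False * sp by simp
    qed
    moreover have "Poly_Mapping.lookup (Lam I J :: biword \<Rightarrow>\<^sub>0 'k) (c, \<tau>) = 0" if "I \<in> compositions n" for I J
      using lookup_Lam[OF that, of J c \<tau>, where 'a = 'k] False by auto
    ultimately show ?thesis
      unfolding b lookup_sum lookup_smult by simp
  qed
qed

end
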